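(* Let $p$ be an odd prime, let $n,k,t$ be positive integers, and let $f\in\mathcal{GB}_n^{p^k}$ with $f(\mathbf{x})=\sum_{i=1}^{k}p^{i-1}a_i(\mathbf{x})$ for some functions $a_i:\mathbb{Z}_p^n\to\mathbb{Z}_p$, $1\le i\le k$. Let $\mathbf{c}=(c_1,\dots,c_{s-1})\in\mathbb{Z}_{p^t}^{s-1}$, and denote $$g_{\mathbf{c}}(\mathbf{x})=\sum_{i=1}^{k-ts}p^{i-1}a_{t(s-1)+i}(\mathbf{x})+p^{k-ts}\left(\sum_{i=1}^{s-1}c_i\Big(\sum_{j=1}^{t}p^{j-1}a_{(i-1)t+j}(\mathbf{x})\Big)+\sum_{j=1}^{t}p^{j-1}a_{k-t+j}(\mathbf{x})\right).$$ Then $f$ is gbent if and only if $g_{\mathbf{c}}$ is gbent in $\mathcal{GB}_n^{p^{k-(s-1)t}}$ for any $s$ satisfying $st\le k$, and there exist some $\mathbf{d}\in\mathbb{Z}_{p^t}^{s-1}$ and $j\in\mathbb{Z}_{p^{k-(s-1)t}}$ such that $$\mathcal{H}_{g_{\mathbf{c}}}(\mathbf{u})=\begin{cases}\pm\,\zeta_{p^{k-(s-1)t}}^{j}\zeta_{p^t}^{\mathbf{c}\cdot\mathbf{d}} & \text{if } n \text{ is even, or } n \text{ is odd and } p\equiv 1 \pmod 4,\\ \pm\sqrt{-1}\,\zeta_{p^{k-(s-1)t}}^{j}\zeta_{p^t}^{\mathbf{c}\cdot\mathbf{d}} & \text{if } n \text{ is odd and } p\equiv 3 \pmod 4,\end{cases}$$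 where $j$ and $\mathbf{d}$ only depend on $\mathbf{u}$ and $f$.
   Context: $\mathbb{Z}_m$ is the ring of integers modulo $m$, and $\zeta_m=e^{2\pi\sqrt{-1}/m}$. $\mathcal{GB}_n^{p^r}$ is the set of all functions $\mathbb{Z}_p^n\to\mathbb{Z}_{p^r}$. For $F\in\mathcal{GB}_n^{p^r}$ the generalized Walsh-Hadamard transform is $\mathcal{H}_F(\mathbf{u})=p^{-n/2}\sum_{\mathbf{x}\in\mathbb{Z}_p^n}\zeta_p^{-\mathbf{u}\cdot\mathbf{x}}\zeta_{p^r}^{F(\mathbf{x})}$ for $\mathbf{u}\in\mathbb{Z}_p^n$; $F$ is called gbent if $|\mathcal{H}_F(\mathbf{u})|=1$ for all $\mathbf{u}\in\mathbb{Z}_p^n$. Here $s$ is a positive integer, $\mathbf{u}$ denotes an element of $\mathbb{Z}_p^n$, and inner products are $\mathbf{x}\cdot\mathbf{y}=\sum_i x_iy_i$ in the relevant ring. In expansions such as $\sum p^{i-1}a_i(\mathbf{x})$, elements of $\mathbb{Z}_p$ (and of $\mathbb{Z}_{p^r}$) are identified with their representatives in $\{0,\dots,p-1\}$ (resp. $\{0,\dots,p^r-1\}$). Empty sums are $0$ and $\mathbb{Z}_{p^t}^{0}$ has one element.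
   Formalization: The equivalence is stated for each fixed s with st ≤ k, g_c ranges over all c, and the sign ± must, like j and d, be the same for all c (depend only on u and f); if the sign could vary with c, the "if" direction would be false for fixed s. *)

theory Defs
  imports "HOL-Number_Theory.Residues" Complex_Main "HOL-Library.FuncSet"
begin

text \<open>
  Elements of \<open>\<int>\<^sub>m\<close> are their representatives in \<open>{0, \<dots>, m - 1}\<close>, the carrier of
  \<^term>\<open>residue_ring (int m)\<close>. Vectors of \<open>\<int>\<^sub>m\<^sup>n\<close> are indexed by \<open>1, \<dots>, n\<close>; they are
  extensional functions, so that \<open>\<int>\<^sub>m\<^sup>n\<close> has exactly \<open>m\<^sup>n\<close> elements (one if \<open>n = 0\<close>).
\<close>

definition Zmod :: "nat \<Rightarrow> int set" where
  "Zmod m = carrier (residue_ring (int m))"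

definition Zvec :: "nat \<Rightarrow> nat \<Rightarrow> (nat \<Rightarrow> int) set" where
  "Zvec m n = {1..n} \<rightarrow>\<^sub>E Zmod m"

definition dotp :: "nat \<Rightarrow> nat \<Rightarrow> (nat \<Rightarrow> int) \<Rightarrow> (nat \<Rightarrow> int) \<Rightarrow> int" where
  "dotp m n x y = (\<Sum>i=1..n. x i * y i) mod int m"

definition zeta :: "nat \<Rightarrow> complex" where
  "zeta m = exp (2 * of_real pi * \<i> / of_nat m)"

text \<open>\<open>GB p n r\<close> is \<open>\<G>\<B>\<^sub>n\<close> with values modulo \<open>p\<^sup>r\<close>; values off \<^term>\<open>Zvec p n\<close> are irrelevant.\<close>

definition GB :: "nat \<Rightarrow> nat \<Rightarrow> nat \<Rightarrow> ((nat \<Rightarrow> int) \<Rightarrow> int) set" where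
  "GB p n r = Zvec p n \<rightarrow> Zmod (p ^ r)"

definition WHT :: "nat \<Rightarrow> nat \<Rightarrow> nat \<Rightarrow> ((nat \<Rightarrow> int) \<Rightarrow> int) \<Rightarrow> (nat \<Rightarrow> int) \<Rightarrow> complex" where
  "WHT p n r F u = of_real (real p powr (- real n / 2)) *
     (\<Sum>x\<in>Zvec p n. zeta p powi (- dotp p n u x) * zeta (p ^ r) powi F x)"

definition gbent :: "nat \<Rightarrow> nat \<Rightarrow> nat \<Rightarrow> ((nat \<Rightarrow> int) \<Rightarrow> int) \<Rightarrow> bool" where
  "gbent p n r F \<longleftrightarrow> F \<in> GB p n r \<and> (\<forall>u\<in>Zvec p n. cmod (WHT p n r F u) = 1)"

text \<open>
  The function \<open>g\<^sub>c\<close>, with values modulo \<open>p ^ (k - (s - 1) * t)\<close>. The second bracket is an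
  element of \<open>\<int>\<close> modulo \<open>p ^ t\<close>; reducing it is unnecessary, as it is multiplied by
  \<open>p ^ (k - t * s)\<close>. The truncated subtractions are exact when \<open>s \<ge> 1\<close> and \<open>s * t \<le> k\<close>.
\<close>

definition gfun :: "nat \<Rightarrow> nat \<Rightarrow> nat \<Rightarrow> nat \<Rightarrow> (nat \<Rightarrow> (nat \<Rightarrow> int) \<Rightarrow> int) \<Rightarrow>
    (nat \<Rightarrow> int) \<Rightarrow> (nat \<Rightarrow> int) \<Rightarrow> int" where
  "gfun p k t s a c x =
     ((\<Sum>i=1..k - t * s. int p ^ (i - 1) * a (t * (s - 1) + i) x) +
      int p ^ (k - t * s) *
        ((\<Sum>i=1..s - 1. c i * (\<Sum>j=1..t. int p ^ (j - 1) * a ((i - 1) * t + j) x)) +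
         (\<Sum>j=1..t. int p ^ (j - 1) * a (k - t + j) x)))
     mod int (p ^ (k - (s - 1) * t))"

end

theory Submission
  imports Defs "Jordan_Normal_Form.Char_Poly"
begin


text \<open>
  Let \<open>\<zeta>\<close> be a primitive root of unity of order \<open>p\<^sup>k\<close>. The Walsh-Hadamard transform of \<open>f\<close> at \<open>u\<close>
  is, up to the factor \<open>p\<^bsup>-n/2\<^esup>\<close>, the cyclotomic integer \<open>w = \<Sum>\<^sub>x \<zeta>\<^sub>p\<^bsup>-u\<bullet>x\<^esup> \<zeta>\<^bsup>f(x)\<^esup>\<close>, and \<open>f\<close> is gbent if
  and only if \<open>w\<close> times its conjugate is \<open>p\<^sup>n\<close> for every \<open>u\<close>.

  Suppose that this holds. The ring \<open>\<int>[\<zeta>]\<close> has only one prime \<open>\<pi> = 1 - \<zeta>\<close> above \<open>p\<close>, and complex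
  conjugation preserves it, so \<open>w\<close> is divisible by \<open>G\<^sup>n\<close>, where \<open>G\<close> is a square root of \<open>p\<close> or \<open>-p\<close> in
  \<open>\<int>[\<zeta>\<^sub>p]\<close> (\<open>div_p_pow_of_norm\<close>, \<open>gauss_root_norm\<close>). The quotient is a cyclotomic integer of absolute
  value one, hence \<open>\<plusminus>\<zeta>\<^sup>m\<close> (\<open>unit_norm_imp_root_of_unity\<close>), and \<open>w = \<plusminus>\<zeta>\<^sup>m G\<^sup>n\<close>. The factor \<open>G\<^sup>n\<close> accounts
  for the distinction between \<open>\<plusminus>1\<close> and \<open>\<plusminus>\<i>\<close>.

  The passage to \<open>g\<^sub>c\<close> is linear. All linear relations between powers of \<open>\<zeta>\<close> follow from
  \<open>\<Sum>\<^sub>j \<zeta>\<^sub>p\<^sup>j = 0\<close>, so a map that sends \<open>\<zeta>\<^sup>v\<close> to any \<open>\<chi>(v)\<close> with \<open>\<chi>(v + p\<^bsup>k-1\<^esup>) = \<zeta>\<^sub>p \<chi>(v)\<close> extends to a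
  \<open>\<int>[\<zeta>\<^sub>p]\<close>-linear map on \<open>\<int>[\<zeta>]\<close> (\<open>lin_ext_eq_0\<close>). Cut the base \<open>p\<close> digits of \<open>v\<close> into \<open>s - 1\<close> low
  blocks of length \<open>t\<close> and a high part, and let \<open>\<chi>(v)\<close> be the root of unity of order \<open>p\<^bsup>k-(s-1)t\<^esup>\<close> with
  exponent the high part, times the character \<open>c\<close> of \<open>(\<int>/p\<^sup>t\<int>)\<^bsup>s-1\<^esup>\<close> evaluated at the vector of blocks.
  The resulting map carries the transform of \<open>f\<close> to that of \<open>g\<^sub>c\<close>, and \<open>w = \<plusminus>\<zeta>\<^sup>m G\<^sup>n\<close> to the asserted
  formula; \<open>j\<close> is the high part of \<open>m\<close> and \<open>d\<close> is its vector of blocks, for all \<open>c\<close> at once.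

  Conversely, as \<open>c\<close> varies, the transforms of the functions \<open>g\<^sub>c\<close> at \<open>u\<close> are the Fourier
  coefficients of a weight on \<open>(\<int>/p\<^sup>t\<int>)\<^bsup>s-1\<^esup>\<close>, which collects the terms of the sum by the vector of blocks
  of \<open>f(x)\<close>. Coefficients of the form \<open>A \<zeta>\<^bsup>c\<bullet>d\<^esup>\<close> say that this weight is concentrated at \<open>d\<close>
  (\<open>fourier_concentration\<close>), and the transform of \<open>f\<close> is then \<open>A\<close> times a root of unity.
\<close>

section \<open>Roots of unity\<close>

lemma zeta_nonzero [simp]: "zeta m \<noteq> 0"
  by (simp add: zeta_def)

lemma norm_zeta [simp]: "cmod (zeta m) = 1"
  by (simp add: zeta_def norm_exp_eq_Re)

lemma zeta_cis: "zeta m = cis (2 * pi / real m)"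
  by (simp add: zeta_def cis_conv_exp mult_ac)

lemma zeta_pow: "zeta m ^ a = cis (2 * pi * real a / real m)"
  by (simp add: zeta_cis Complex.DeMoivre mult_ac)

lemma zeta_pow_self: "m > 0 \<Longrightarrow> zeta m ^ m = 1"
  by (simp add: zeta_pow)

lemma zeta_mult_power: "l > 0 \<Longrightarrow> zeta (m * l) ^ l = zeta m"
  using zeta_pow[of "m * l" l] zeta_pow[of m 1] by simp

lemma zeta_pow_mod: "m > 0 \<Longrightarrow> zeta m ^ (a mod m) = zeta m ^ a"
  by (metis mult_div_mod_eq power_add power_mult zeta_pow_self power_one mult_1)

lemma zeta_pow_inj: "m > 0 \<Longrightarrow> inj_on (\<lambda>a. zeta m ^ a) {..<m}"
  using bij_betw_roots_unity[of m] by (auto simp: bij_betw_def zeta_pow)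

lemma zeta_pow_eq_1_iff:
  assumes "m > 0"
  shows "zeta m ^ a = 1 \<longleftrightarrow> m dvd a"
proof
  assume "zeta m ^ a = 1"
  hence "zeta m ^ (a mod m) = zeta m ^ 0"
    by (simp add: zeta_pow_mod assms)
  hence "a mod m = 0"
    using inj_onD[OF zeta_pow_inj[OF assms], of "a mod m" 0] assms by simp
  thus "m dvd a" by auto
qed (use assms in \<open>auto simp: power_mult zeta_pow_self\<close>)

lemma cnj_zeta: "cnj (zeta m) = inverse (zeta m)"
  by (simp add: zeta_cis cis_cnj cis_inverse)

lemma zeta_powi_mod: "m > 0 \<Longrightarrow> zeta m powi (a mod int m) = zeta m powi a"
proof -
  assume m: "m > 0"
  have "zeta m powi a = zeta m powi (int m * (a div int m) + a mod int m)"
    by simp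
  also have "\<dots> = zeta m powi (a mod int m)"
    using m by (subst power_int_add) (simp_all add: power_int_mult zeta_pow_self)
  finally show ?thesis by simp
qed

lemma zeta_powi_mult: "l > 0 \<Longrightarrow> zeta (m * l) powi (int l * a) = zeta m powi a"
  by (simp add: power_int_mult zeta_mult_power)

lemma norm_zeta_powi [simp]: "cmod (zeta m powi a) = 1"
  by (simp add: norm_power_int)


section \<open>The ring of integers generated by a root of unity\<close>

definition cyc_ints :: "nat \<Rightarrow> complex set" where
  "cyc_ints m = range (\<lambda>P. poly (of_int_poly P) (zeta m))"

lemma cyc_ints_add [intro]: "a \<in> cyc_ints m \<Longrightarrow> b \<in> cyc_ints m \<Longrightarrow> a + b \<in> cyc_ints m"
  unfolding cyc_ints_def by (auto simp flip: poly_add of_int_poly_hom.hom_add)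

lemma cyc_ints_mult [intro]: "a \<in> cyc_ints m \<Longrightarrow> b \<in> cyc_ints m \<Longrightarrow> a * b \<in> cyc_ints m"
  unfolding cyc_ints_def by (auto simp flip: poly_mult of_int_poly_hom.hom_mult)

lemma cyc_ints_of_int [intro, simp]: "of_int c \<in> cyc_ints m"
proof -
  have "of_int_poly [:c:] = [:complex_of_int c:]"
    by (rule poly_eqI) (simp add: coeff_map_poly coeff_pCons split: nat.split)
  thus ?thesis
    unfolding cyc_ints_def by (intro range_eqI[of _ _ "[:c:]"]) simp
qed

lemma cyc_ints_0 [intro, simp]: "0 \<in> cyc_ints m" and cyc_ints_1 [intro, simp]: "1 \<in> cyc_ints m"
  using cyc_ints_of_int[of 0 m] cyc_ints_of_int[of 1 m] by auto

lemma cyc_ints_uminus [intro]: "a \<in> cyc_ints m \<Longrightarrow> - a \<in> cyc_ints m"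
  using cyc_ints_mult[OF cyc_ints_of_int[of "-1" m]] by fastforce

lemma cyc_ints_diff [intro]: "a \<in> cyc_ints m \<Longrightarrow> b \<in> cyc_ints m \<Longrightarrow> a - b \<in> cyc_ints m"
  using cyc_ints_add[OF _ cyc_ints_uminus, of a m b] by simp

lemma cyc_ints_power [intro]: "a \<in> cyc_ints m \<Longrightarrow> a ^ e \<in> cyc_ints m"
  by (induction e) auto

lemma cyc_ints_sum [intro]: "(\<And>x. x \<in> A \<Longrightarrow> f x \<in> cyc_ints m) \<Longrightarrow> sum f A \<in> cyc_ints m"
  by (induction A rule: infinite_finite_induct) auto

lemma cyc_ints_prod [intro]: "(\<And>x. x \<in> A \<Longrightarrow> f x \<in> cyc_ints m) \<Longrightarrow> prod f A \<in> cyc_ints m"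
  by (induction A rule: infinite_finite_induct) auto

lemma cyc_ints_zeta [intro, simp]: "zeta m \<in> cyc_ints m"
  unfolding cyc_ints_def by (rule range_eqI[of _ _ "[:0, 1:]"]) simp

lemma cyc_ints_poly [intro]: "a \<in> cyc_ints m \<Longrightarrow> poly (of_int_poly P) a \<in> cyc_ints m"
  by (simp add: poly_altdef) auto

lemma cyc_ints_inverse_zeta: "m > 0 \<Longrightarrow> inverse (zeta m) \<in> cyc_ints m"
proof -
  assume m: "m > 0"
  have "zeta m * zeta m ^ (m - 1) = 1"
    using zeta_pow_self[OF m] m by (metis power_eq_if not_gr_zero)
  hence "inverse (zeta m) = zeta m ^ (m - 1)"
    by (metis inverse_unique)
  thus ?thesis by auto
qed

lemma cyc_ints_cnj [intro]: "m > 0 \<Longrightarrow> a \<in> cyc_ints m \<Longrightarrow> cnj a \<in> cyc_ints m"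
proof -
  assume m: "m > 0" and "a \<in> cyc_ints m"
  then obtain P where a: "a = poly (of_int_poly P) (zeta m)"
    by (auto simp: cyc_ints_def)
  have "cnj a = poly (of_int_poly P) (inverse (zeta m))"
    by (simp add: a poly_altdef cnj_zeta)
  thus ?thesis
    using cyc_ints_inverse_zeta[OF m] by auto
qed

lemma cyc_ints_powi [intro]: "m > 0 \<Longrightarrow> zeta m powi a \<in> cyc_ints m"
  unfolding power_int_def using cyc_ints_inverse_zeta by auto

text \<open>
  Multiplication by an element of \<open>\<int>[\<zeta>\<^sub>m]\<close> acts on the powers of \<open>\<zeta>\<^sub>m\<close> by an integer matrix, so
  the element is an eigenvalue of that matrix and a root of its characteristic polynomial.
\<close>

lemma cyc_ints_algebraic_int:
  assumes m: "m > 0" and a: "a \<in> cyc_ints m"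
  shows "algebraic_int a"
proof -
  \<comment> \<open>Row \<open>x\<close> of \<open>A\<close> expresses \<open>a * \<zeta>\<^sup>x\<close> in terms of \<open>1, \<zeta>, \<dots>, \<zeta>\<^bsup>m-1\<^esup>\<close>.\<close>
  obtain P where P: "a = poly (of_int_poly P) (zeta m)"
    using a by (auto simp: cyc_ints_def)
  define d where "d = degree P"
  define A where "A = mat m m (\<lambda>(x, y). \<Sum>i\<in>{i. i \<le> d \<and> (x + i) mod m = y}. coeff P i)"
  define v where "v = vec m (\<lambda>y. zeta m ^ y)"
  let ?A = "map_mat of_int A :: complex mat"
  have A: "A \<in> carrier_mat m m" by (simp add: A_def)
  have v: "v \<in> carrier_vec m" by (simp add: v_def)
  have "?A *\<^sub>v v = a \<cdot>\<^sub>v v"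
  proof (rule eq_vecI)
    fix x assume "x < dim_vec (a \<cdot>\<^sub>v v)"
    hence x: "x < m" by (simp add: v_def)
    have "(?A *\<^sub>v v) $ x = (\<Sum>y<m. (\<Sum>i\<in>{i. i \<le> d \<and> (x + i) mod m = y}. of_int (coeff P i)) * zeta m ^ y)"
      using x by (simp add: A_def v_def scalar_prod_def atLeast0LessThan)
    also have "\<dots> = (\<Sum>y<m. \<Sum>i\<in>{i. i \<in> {..d} \<and> (x + i) mod m = y}. of_int (coeff P i) * zeta m ^ (x + i))"
      unfolding sum_distrib_right
      by (intro sum.cong) (auto simp: zeta_pow_mod m)
    also have "\<dots> = (\<Sum>i\<in>{..d}. of_int (coeff P i) * zeta m ^ (x + i))"
      by (rule sum.group) (use m in auto)
    also have "\<dots> = a * zeta m ^ x"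
      by (simp add: P poly_altdef d_def power_add sum_distrib_left sum_distrib_right mult_ac)
    finally show "(?A *\<^sub>v v) $ x = (a \<cdot>\<^sub>v v) $ x"
      using x by (simp add: v_def)
  qed (use A in \<open>simp add: v_def\<close>)
  moreover have "v \<noteq> 0\<^sub>v m"
  proof
    assume "v = 0\<^sub>v m"
    hence "v $ 0 = 0\<^sub>v m $ 0" by simp
    thus False using m by (simp add: v_def)
  qed
  ultimately have "eigenvalue ?A a"
    using A v by (auto simp: eigenvalue_def eigenvector_def)
  hence "poly (char_poly ?A) a = 0"
    using eigenvalue_root_char_poly[of ?A m a] A by simp
  hence "poly (of_int_poly (char_poly A)) a = 0"
    by (simp add: of_int_hom.char_poly_hom[OF A])
  moreover have "lead_coeff (char_poly A) = 1"
    using degree_monic_char_poly[OF A] by simp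
  ultimately show ?thesis
    by (auto simp: algebraic_int_altdef_ipoly)
qed


section \<open>Arithmetic in prime power cyclotomic rings\<close>

locale prime_power_cyclotomic =
  fixes p k :: nat
  assumes prime_p: "prime p" and k_pos: "k \<ge> 1"
begin

abbreviation q where "q \<equiv> p ^ k"
abbreviation r where "r \<equiv> p ^ (k - 1)"
abbreviation z where "z \<equiv> zeta q"
abbreviation \<phi> where "\<phi> \<equiv> r * (p - 1)"
abbreviation R where "R \<equiv> cyc_ints q"

definition \<pi> where "\<pi> = 1 - z"

lemma pi_in_R [intro, simp]: "\<pi> \<in> R"
  unfolding \<pi>_def by auto

lemma p_gt_1: "p > 1" and q_pos: "q > 0" and r_pos: "r > 0"
  using prime_gt_1_nat[OF prime_p] by simp_all

lemma q_eq: "q = r * p"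
  using k_pos by (cases k) simp_all

lemma q_gt_1: "q > 1"
  using p_gt_1 k_pos by (intro one_less_power) simp_all

lemma pi_nonzero [simp]: "\<pi> \<noteq> 0"
  unfolding \<pi>_def using zeta_pow_eq_1_iff[OF q_pos, of 1] q_gt_1 by auto

lemma z_pow_r: "z ^ r = zeta p"
  using zeta_mult_power[OF r_pos, of p] by (simp add: q_eq mult.commute)

lemma coprime_q_iff: "coprime a q \<longleftrightarrow> \<not> p dvd a"
proof -
  have "coprime a q \<longleftrightarrow> coprime p a"
    using k_pos by (simp add: coprime_commute)
  also have "\<dots> \<longleftrightarrow> \<not> p dvd a"
    using prime_p p_gt_1 prime_imp_coprime_nat[of p a]
    by (metis coprime_common_divisor_nat dvd_refl nat_neq_iff)
  finally show ?thesis .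
qed

text \<open>
  The cyclotomic polynomial of order \<open>p\<^sup>k\<close>; irreducibility enters as the lemma
  \<open>powers_of_zeta_independent\<close> below.
\<close>

definition Phi :: "int poly" where
  "Phi = (\<Sum>i<p. monom 1 (i * r))"

lemma poly_Phi: "poly (of_int_poly Phi) (x :: complex) = (\<Sum>i<p. (x ^ r) ^ i)"
  by (simp add: Phi_def of_int_poly_hom.hom_sum poly_sum poly_monom mult.commute flip: power_mult)

lemma degree_Phi_le: "degree Phi \<le> \<phi>"
  unfolding Phi_def
proof (rule degree_sum_le)
  fix i assume "i \<in> {..<p}"
  hence "i * r \<le> \<phi>" using p_gt_1 by (simp add: mult.commute)
  thus "degree (monom (1 :: int) (i * r)) \<le> \<phi>"
    using degree_monom_le le_trans by blast
qed simp

lemma coeff_Phi: "coeff Phi \<phi> = 1"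
proof -
  have "coeff Phi \<phi> = (\<Sum>i<p. if i = p - 1 then 1 else 0)"
    unfolding Phi_def coeff_sum
    by (intro sum.cong) (use r_pos in \<open>auto simp: mult.commute\<close>)
  also have "\<dots> = 1" using p_gt_1 by simp
  finally show ?thesis .
qed

lemma degree_Phi: "degree Phi = \<phi>"
  using degree_Phi_le coeff_Phi le_degree[of Phi \<phi>] by simp

lemma Phi_root:
  assumes "a \<in> totatives q"
  shows "poly (of_int_poly Phi) (z ^ a) = 0"
proof -
  let ?y = "(z ^ a) ^ r"
  have "\<not> p dvd a"
    using assms coprime_q_iff by (auto simp: totatives_def)
  have "?y = z ^ (a * r)" by (simp add: power_mult)
  moreover have "\<not> q dvd a * r"
    unfolding q_eq mult.commute[of a] using \<open>\<not> p dvd a\<close> r_pos nat_mult_dvd_cancel1 by blast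
  ultimately have "?y \<noteq> 1"
    using zeta_pow_eq_1_iff[OF q_pos] by metis
  moreover have "?y ^ p = 1"
  proof -
    have "?y ^ p = (z ^ q) ^ a"
      by (simp add: q_eq mult_ac flip: power_mult)
    thus ?thesis using q_pos by (simp add: zeta_pow_self)
  qed
  ultimately show ?thesis
    by (simp add: poly_Phi sum_gp_strict)
qed

lemma one_in_totatives: "1 \<in> totatives q"
  using q_pos by (auto simp: totatives_def)

lemma Phi_z: "poly (of_int_poly Phi) z = 0"
  using Phi_root[OF one_in_totatives] by simp

lemma card_totatives: "card (totatives q) = \<phi>"
  using totient_prime_power[OF prime_p, of k] k_pos by (simp add: totient_def)

lemma Phi_factor: "of_int_poly Phi = (\<Prod>a\<in>totatives q. [:- (z ^ a), 1:])"
proof (rule poly_eqI_degree_lead_coeff)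
  let ?P = "\<Prod>a\<in>totatives q. [:- (z ^ a), 1:]"
  have deg: "degree ?P = \<phi>"
    by (subst degree_prod_eq_sum_degree) (auto simp: card_totatives)
  thus "degree ?P \<le> \<phi>" by simp
  have "lead_coeff ?P = 1"
    by (simp add: lead_coeff_prod)
  thus "coeff (of_int_poly Phi) \<phi> = coeff ?P \<phi>"
    using coeff_Phi unfolding deg by simp
  show "degree (of_int_poly Phi :: complex poly) \<le> \<phi>"
    using degree_Phi by simp
  have "inj_on (\<lambda>a. z ^ a) (totatives q)"
  proof (rule inj_onI)
    fix a b assume ab: "a \<in> totatives q" "b \<in> totatives q" "z ^ a = z ^ b"
    have lt: "c < q" if "c \<in> totatives q" for c
      using that q_gt_1 by (auto simp: totatives_def le_less)
    show "a = b"
      using inj_onD[OF zeta_pow_inj[OF q_pos] ab(3)] lt ab by auto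
  qed
  thus "card ((\<lambda>a. z ^ a) ` totatives q) \<ge> \<phi>"
    by (simp add: card_image card_totatives)
next
  fix y assume "y \<in> (\<lambda>a. z ^ a) ` totatives q"
  thus "poly (of_int_poly Phi) y = poly (\<Prod>a\<in>totatives q. [:- (z ^ a), 1:]) y"
    by (auto simp: Phi_root poly_prod intro!: prod_zero)
qed

lemma prod_one_minus: "(\<Prod>a\<in>totatives q. 1 - z ^ a) = of_nat p"
proof -
  have "poly (of_int_poly Phi) (1 :: complex) = of_nat p"
    by (subst poly_Phi) simp
  thus ?thesis
    by (simp add: Phi_factor poly_prod)
qed

lemma one_minus_pow_div: "(1 - z ^ a) / \<pi> \<in> R"
proof -
  have "1 - z ^ a = \<pi> * (\<Sum>i<a. z ^ i)"
    unfolding \<pi>_def by (rule one_diff_power_eq)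
  thus ?thesis by auto
qed

lemma pi_div_one_minus_pow:
  assumes "a \<in> totatives q"
  shows "\<pi> / (1 - z ^ a) \<in> R"
proof -
  have "coprime a q" using assms by (auto simp: totatives_def)
  then obtain b where "[a * b = 1] (mod q)"
    using cong_solve_coprime_nat[of a q] by auto
  hence "z ^ (a * b) = z ^ 1"
    using zeta_pow_mod[OF q_pos] by (metis cong_def)
  hence "\<pi> = (1 - z ^ a) * (\<Sum>i<b. (z ^ a) ^ i)"
    unfolding \<pi>_def by (metis one_diff_power_eq power_mult power_one_right)
  moreover from this have "1 - z ^ a \<noteq> 0" by auto
  ultimately show ?thesis by auto
qed

text \<open>The prime \<open>p\<close> is totally ramified: up to a unit, it is the power \<open>\<phi>\<close> of \<open>\<pi>\<close>.\<close>

lemma p_div_pi_pow: "of_nat p / \<pi> ^ \<phi> \<in> R"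
proof -
  have "of_nat p / \<pi> ^ \<phi> = (\<Prod>a\<in>totatives q. (1 - z ^ a) / \<pi>)"
    by (simp add: prod_dividef prod_one_minus card_totatives)
  thus ?thesis using one_minus_pow_div by auto
qed

lemma pi_pow_div_p: "\<pi> ^ \<phi> / of_nat p \<in> R"
proof -
  have "\<pi> ^ \<phi> / of_nat p = (\<Prod>a\<in>totatives q. \<pi> / (1 - z ^ a))"
    by (simp add: prod_dividef prod_one_minus card_totatives)
  thus ?thesis using pi_div_one_minus_pow by auto
qed

lemma phi_pos: "\<phi> > 0"
  using r_pos p_gt_1 by simp

lemma p_div_pi: "of_nat p / \<pi> \<in> R"
proof -
  obtain e where e: "\<phi> = Suc e"
    using phi_pos gr0_implies_Suc by blast
  have "of_nat p / \<pi> = of_nat p / \<pi> ^ \<phi> * \<pi> ^ e"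
    unfolding e by (simp add: field_simps)
  also have "\<dots> \<in> R"
    using p_div_pi_pow by blast
  finally show ?thesis .
qed

text \<open>
  If \<open>\<pi>\<close> were a unit then so would be \<open>p\<close>, but \<open>1/p\<close> is not an algebraic integer.
\<close>

lemma pi_nonunit: "1 / \<pi> \<notin> R"
proof
  assume "1 / \<pi> \<in> R"
  hence "\<pi> ^ \<phi> / of_nat p * (1 / \<pi>) ^ \<phi> \<in> R"
    using pi_pow_div_p by blast
  hence "1 / of_nat p \<in> R"
    using pi_nonzero by (simp add: field_simps)
  hence "algebraic_int (1 / of_nat p :: complex)"
    using cyc_ints_algebraic_int q_pos by blast
  hence "1 / of_nat p \<in> (\<int> :: complex set)"
    by (rule rational_algebraic_int_is_int) auto
  then obtain c where "1 / of_nat p = (of_int c :: complex)"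
    by (auto elim: Ints_cases)
  hence "(of_int (c * int p) :: complex) = of_int 1"
    using p_gt_1 by (simp add: field_simps)
  hence "c * int p = 1"
    using of_int_eq_iff by blast
  thus False using p_gt_1 by (auto simp: zmult_eq_1_iff)
qed

text \<open>Since \<open>\<zeta> \<equiv> 1\<close> modulo \<open>\<pi>\<close>, the residue ring of \<open>\<pi>\<close> is a quotient of \<open>\<int>\<close>.\<close>

lemma cong_int_mod_pi:
  assumes "a \<in> R"
  obtains c :: int where "(a - of_int c) / \<pi> \<in> R"
proof -
  obtain P where P: "a = poly (of_int_poly P) z"
    using assms by (auto simp: cyc_ints_def)
  have "a - of_int (poly P 1) = (\<Sum>i\<le>degree P. of_int (coeff P i) * (z ^ i - 1))"
    by (simp add: P poly_altdef algebra_simps sum_subtractf)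
  hence "(a - of_int (poly P 1)) / \<pi> = - (\<Sum>i\<le>degree P. of_int (coeff P i) * ((1 - z ^ i) / \<pi>))"
    using pi_nonzero by (simp add: sum_divide_distrib[symmetric] sum_negf[symmetric] field_simps)
  also have "\<dots> \<in> R"
    by (intro cyc_ints_uminus cyc_ints_sum cyc_ints_mult cyc_ints_of_int one_minus_pow_div)
  finally show ?thesis using that by blast
qed

lemma int_div_pi_imp_dvd:
  assumes "of_int c / \<pi> \<in> R"
  shows "int p dvd c"
proof (rule ccontr)
  assume "\<not> int p dvd c"
  hence "coprime (int p) c"
    using prime_p by (simp add: prime_imp_coprime_int)
  then obtain x y where "x * int p + y * c = 1"
    using bezout_int[of "int p" c] by auto
  hence "1 / \<pi> = of_int (x * int p + y * c) / \<pi>" by simp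
  also have "\<dots> = of_int x * (of_nat p / \<pi>) + of_int y * (of_int c / \<pi>)"
    by (simp add: add_divide_distrib)
  also have "\<dots> \<in> R"
    using assms p_div_pi by (intro cyc_ints_add cyc_ints_mult cyc_ints_of_int)
  finally show False using pi_nonunit by simp
qed

text \<open>The residue ring of \<open>\<pi>\<close> is the field \<open>\<int>/p\<int>\<close>.\<close>

lemma pi_prime:
  assumes "a \<in> R" "b \<in> R" "a * b / \<pi> \<in> R"
  shows "a / \<pi> \<in> R \<or> b / \<pi> \<in> R"
proof -
  obtain c d where c: "(a - of_int c) / \<pi> \<in> R" and d: "(b - of_int d) / \<pi> \<in> R"
    using cong_int_mod_pi assms by metis
  have div: "x / \<pi> \<in> R" if xe: "(x - of_int e) / \<pi> \<in> R" and dvd: "int p dvd e" for x e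
  proof -
    obtain l where "e = int p * l" using dvd by (elim dvdE)
    hence "x / \<pi> = (x - of_int e) / \<pi> + of_nat p / \<pi> * of_int l"
      by (simp add: diff_divide_distrib)
    thus ?thesis using xe p_div_pi by (metis cyc_ints_add cyc_ints_mult cyc_ints_of_int)
  qed
  have "of_int (c * d) / \<pi> = a * b / \<pi> - (a - of_int c) / \<pi> * b - of_int c * ((b - of_int d) / \<pi>)"
    using pi_nonzero by (simp add: field_simps)
  also have "\<dots> \<in> R"
    using assms c d by (intro cyc_ints_diff cyc_ints_mult cyc_ints_of_int)
  finally have "int p dvd c * d"
    by (rule int_div_pi_imp_dvd)
  hence "int p dvd c \<or> int p dvd d"
    using prime_p by (simp add: prime_dvd_mult_iff)
  thus ?thesis using div c d by blast
qed

lemma cnj_pi: "cnj \<pi> = - \<pi> / z"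
  by (simp add: \<pi>_def cnj_zeta field_simps)

text \<open>
  Complex conjugation fixes the prime \<open>\<pi>\<close> up to a unit, so \<open>\<pi>\<close> divides \<open>v\<close> and its conjugate
  equally often, and hence half as often as their product.
\<close>

lemma div_pi_pow_of_norm:
  assumes "v \<in> R" "v * cnj v / \<pi> ^ (2 * M) \<in> R"
  shows "v / \<pi> ^ M \<in> R"
  using assms
proof (induction M arbitrary: v)
  case (Suc M)
  have "v * cnj v / \<pi> = v * cnj v / \<pi> ^ (2 * Suc M) * \<pi> ^ (2 * M + 1)"
    by (simp add: field_simps)
  also have "\<dots> \<in> R"
    using Suc.prems by (intro cyc_ints_mult cyc_ints_power pi_in_R)
  finally have "v / \<pi> \<in> R \<or> cnj v / \<pi> \<in> R"
    using pi_prime Suc.prems(1) cyc_ints_cnj q_pos by blast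
  moreover have "v / \<pi> \<in> R" if "cnj v / \<pi> \<in> R"
  proof -
    have "cnj (cnj v / \<pi>) \<in> R" using that cyc_ints_cnj q_pos by blast
    also have "cnj (cnj v / \<pi>) = - z * (v / \<pi>)"
      unfolding complex_cnj_divide cnj_pi by simp
    finally have "- inverse z * (- z * (v / \<pi>)) \<in> R"
      using cyc_ints_inverse_zeta q_pos by blast
    also have "- inverse z * (- z * (v / \<pi>)) = v / \<pi>"
      by (simp add: field_simps)
    finally show ?thesis .
  qed
  ultimately have v: "v / \<pi> \<in> R" by blast
  have "v / \<pi> * cnj (v / \<pi>) / \<pi> ^ (2 * M) = - z * (v * cnj v / \<pi> ^ (2 * Suc M))"
    unfolding complex_cnj_divide cnj_pi using pi_nonzero by (simp add: field_simps)
  also have "\<dots> \<in> R"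
    using Suc.prems(2) by (intro cyc_ints_mult cyc_ints_uminus cyc_ints_zeta)
  finally have "v / \<pi> / \<pi> ^ M \<in> R"
    by (rule Suc.IH[OF v])
  thus ?case by (simp add: divide_divide_eq_left)
qed simp

lemma div_p_pow_of_norm:
  assumes v: "v \<in> R" and nrm: "v * cnj v = of_nat p ^ (2 * n)"
  shows "v / of_nat p ^ n \<in> R"
proof -
  have "v * cnj v / \<pi> ^ (2 * (\<phi> * n)) = (of_nat p / \<pi> ^ \<phi>) ^ (2 * n)"
    by (simp add: nrm power_divide mult_ac flip: power_mult)
  also have "\<dots> \<in> R" using p_div_pi_pow by auto
  finally have "v / \<pi> ^ (\<phi> * n) \<in> R"
    by (rule div_pi_pow_of_norm[OF v])
  hence "v / \<pi> ^ (\<phi> * n) * (\<pi> ^ \<phi> / of_nat p) ^ n \<in> R"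
    using pi_pow_div_p by (intro cyc_ints_mult cyc_ints_power)
  also have "v / \<pi> ^ (\<phi> * n) * (\<pi> ^ \<phi> / of_nat p) ^ n = v / of_nat p ^ n"
    using pi_nonzero by (simp add: power_divide power_mult)
  finally show ?thesis .
qed

end


section \<open>Linear relations between powers of a root of unity\<close>

text \<open>
  The extension by linearity of \<open>x\<^sup>i \<mapsto> \<chi> i\<close> to integer polynomials. It factors through the
  evaluation at \<open>\<zeta>\<close> if it vanishes on all polynomials with root \<open>\<zeta>\<close>.
\<close>

definition lin_ext :: "(nat \<Rightarrow> complex) \<Rightarrow> int poly \<Rightarrow> complex" where
  "lin_ext \<chi> P = (\<Sum>i\<le>degree P. of_int (coeff P i) * \<chi> i)"

lemma lin_ext_bound:
  assumes "degree P \<le> N"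
  shows "lin_ext \<chi> P = (\<Sum>i\<le>N. of_int (coeff P i) * \<chi> i)"
  unfolding lin_ext_def
  by (rule sum.mono_neutral_left) (use assms in \<open>auto simp: coeff_eq_0\<close>)

lemma lin_ext_0 [simp]: "lin_ext \<chi> 0 = 0"
  by (simp add: lin_ext_def)

lemma lin_ext_add [simp]: "lin_ext \<chi> (P + Q) = lin_ext \<chi> P + lin_ext \<chi> Q"
proof -
  let ?N = "max (degree P) (degree Q)"
  have "lin_ext \<chi> (P + Q) = (\<Sum>i\<le>?N. of_int (coeff (P + Q) i) * \<chi> i)"
    by (intro lin_ext_bound degree_add_le_max)
  also have "\<dots> = lin_ext \<chi> P + lin_ext \<chi> Q"
    by (simp add: lin_ext_bound[of P ?N] lin_ext_bound[of Q ?N] distrib_right sum.distrib)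
  finally show ?thesis .
qed

lemma lin_ext_uminus [simp]: "lin_ext \<chi> (- P) = - lin_ext \<chi> P"
  by (simp add: lin_ext_def sum_negf)

lemma lin_ext_diff [simp]: "lin_ext \<chi> (P - Q) = lin_ext \<chi> P - lin_ext \<chi> Q"
  using lin_ext_add[of \<chi> P "- Q"] by simp

lemma lin_ext_sum: "lin_ext \<chi> (\<Sum>x\<in>A. P x) = (\<Sum>x\<in>A. lin_ext \<chi> (P x))"
  by (induction A rule: infinite_finite_induct) auto

lemma lin_ext_monom [simp]: "lin_ext \<chi> (monom c i) = of_int c * \<chi> i"
proof -
  have "lin_ext \<chi> (monom c i) = (\<Sum>j\<le>i. of_int (coeff (monom c i) j) * \<chi> j)"
    by (intro lin_ext_bound degree_monom_le)
  also have "\<dots> = (\<Sum>j\<le>i. if i = j then of_int c * \<chi> j else 0)"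
    by (intro sum.cong) auto
  finally show ?thesis by simp
qed

context prime_power_cyclotomic
begin

text \<open>
  The powers \<open>1, \<zeta>, \<dots>, \<zeta>\<^bsup>\<phi>-1\<^esup>\<close> are linearly independent. In a relation between powers of \<open>\<pi>\<close>
  of degree less than \<open>\<phi>\<close> with coprime coefficients, the lowest term whose coefficient is prime to \<open>p\<close>
  would be divisible by a higher power of \<open>\<pi>\<close>, since \<open>p\<close> itself is divisible by \<open>\<pi>\<^sup>\<phi>\<close>.
\<close>

lemma powers_of_zeta_independent:
  fixes P :: "int poly"
  assumes root: "poly (of_int_poly P) z = 0" and deg: "degree P < \<phi>"
  shows "P = 0"
proof (rule ccontr)
  assume "P \<noteq> 0"
  \<comment> \<open>\<open>S\<close> rewrites the relation in powers of \<open>\<pi> = 1 - \<zeta>\<close>, and \<open>T\<close> makes the coefficients coprime.\<close>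
  define S where "S = pcompose P [:1, - 1:]"
  define T where "T = primitive_part S"
  have "S \<noteq> 0"
    using \<open>P \<noteq> 0\<close> pcompose_eq_0[of P "[:1, - 1:]"] by (auto simp: S_def)
  have "poly (of_int_poly S) \<pi> = poly (of_int_poly P) (poly (of_int_poly [:1, - 1:]) \<pi>)"
    by (simp add: S_def of_int_hom.map_poly_pcompose poly_pcompose)
  also have "poly (of_int_poly [:1, - 1:]) \<pi> = z"
    by (simp add: \<pi>_def of_int_poly_hom.base.map_poly_pCons_hom)
  finally have "poly (of_int_poly (smult (content S) T)) \<pi> = 0"
    using root by (simp add: T_def)
  hence T0: "poly (of_int_poly T) \<pi> = 0"
    using \<open>S \<noteq> 0\<close> by (simp add: of_int_hom.map_poly_hom_smult)
  have degT: "degree T < \<phi>"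
    using deg by (simp add: T_def S_def degree_pcompose)
  have "\<not> (\<forall>i. int p dvd coeff T i)"
  proof
    assume "\<forall>i. int p dvd coeff T i"
    hence "[:int p:] dvd T" by (simp add: const_poly_dvd_iff)
    hence "int p dvd content T" by (simp add: const_poly_dvd_iff_dvd_content)
    hence "int p dvd 1" using \<open>S \<noteq> 0\<close> by (simp add: T_def)
    thus False using p_gt_1 by simp
  qed
  hence ex: "\<exists>i. \<not> int p dvd coeff T i" by blast
  define m where "m = (LEAST i. \<not> int p dvd coeff T i)"
  have m: "\<not> int p dvd coeff T m" unfolding m_def using ex by (rule LeastI_ex)
  have m_min: "int p dvd coeff T i" if "i < m" for i
    using not_less_Least[of i] that unfolding m_def by blast
  have m_le: "m \<le> degree T"
    using m coeff_eq_0[of T m] by (cases "m \<le> degree T") auto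
  have term_div: "of_int (coeff T i) * \<pi> ^ i / \<pi> ^ Suc m \<in> R" if "i \<noteq> m" for i
  proof (cases "i < m")
    case True
    then obtain e where e: "coeff T i = int p * e" using m_min[of i] by (auto elim: dvdE)
    have "\<phi> = Suc m + (\<phi> - Suc m)" using m_le degT by simp
    hence "\<pi> ^ \<phi> = \<pi> ^ Suc m * \<pi> ^ (\<phi> - Suc m)" by (metis power_add)
    hence "of_int (coeff T i) * \<pi> ^ i / \<pi> ^ Suc m
        = (of_nat p / \<pi> ^ \<phi>) * of_int e * \<pi> ^ i * \<pi> ^ (\<phi> - Suc m)"
      by (simp add: e)
    also have "\<dots> \<in> R"
      using p_div_pi_pow by (intro cyc_ints_mult cyc_ints_power) auto
    finally show ?thesis .
  next
    case False
    hence i: "i = Suc m + (i - Suc m)" using that by simp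
    have "of_int (coeff T i) * \<pi> ^ i / \<pi> ^ Suc m = of_int (coeff T i) * \<pi> ^ (i - Suc m)"
      by (subst (2) i) (simp only: power_add, simp)
    thus ?thesis by auto
  qed
  have "0 = (\<Sum>i\<le>degree T. of_int (coeff T i) * \<pi> ^ i)"
    using T0 by (simp add: poly_altdef)
  also have "\<dots> = of_int (coeff T m) * \<pi> ^ m + (\<Sum>i\<in>{..degree T} - {m}. of_int (coeff T i) * \<pi> ^ i)"
    using m_le by (intro sum.remove) auto
  finally have "of_int (coeff T m) * \<pi> ^ m = - (\<Sum>i\<in>{..degree T} - {m}. of_int (coeff T i) * \<pi> ^ i)"
    by (simp add: eq_neg_iff_add_eq_0)
  hence "of_int (coeff T m) * \<pi> ^ m / \<pi> ^ Suc m
      = - (\<Sum>i\<in>{..degree T} - {m}. of_int (coeff T i) * \<pi> ^ i / \<pi> ^ Suc m)"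
    by (simp add: sum_divide_distrib)
  also have "\<dots> \<in> R"
    using term_div by (intro cyc_ints_uminus cyc_ints_sum) auto
  finally have "of_int (coeff T m) / \<pi> \<in> R" by simp
  hence "int p dvd coeff T m" by (rule int_div_pi_imp_dvd)
  thus False using m by contradiction
qed

lemma Phi_dvd_of_root:
  fixes P :: "int poly"
  assumes root: "poly (of_int_poly P) z = 0"
  shows "Phi dvd P"
proof -
  have Phi0: "Phi \<noteq> 0" using coeff_Phi by auto
  obtain Q S where QS: "pseudo_divmod P Phi = (Q, S)" by fastforce
  have P: "P = Phi * Q + S"
    using pseudo_divmod(1)[OF Phi0 QS] coeff_Phi by (simp add: degree_Phi)
  have "poly (of_int_poly S) z = 0"
    using root Phi_z by (simp add: P of_int_poly_hom.hom_add of_int_poly_hom.hom_mult)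
  moreover have "S = 0 \<or> degree S < \<phi>"
    using pseudo_divmod(2)[OF Phi0 QS] by (simp add: degree_Phi)
  ultimately have "S = 0"
    using powers_of_zeta_independent by blast
  thus ?thesis using P by simp
qed

text \<open>
  All linear relations between the powers of \<open>\<zeta>\<close> are consequences of the vanishing of the sums over
  cosets of the group of \<open>p\<close>-th roots of unity. Hence a map \<open>\<zeta>\<^sup>i \<mapsto> \<chi> i\<close> that respects these extends
  to a well-defined additive map on \<open>\<int>[\<zeta>]\<close>.
\<close>

lemma lin_ext_eq_0:
  assumes coset: "\<And>v. (\<Sum>j<p. \<chi> (v + j * r)) = 0"
    and root: "poly (of_int_poly P) z = 0"
  shows "lin_ext \<chi> P = 0"
proof -
  obtain Q where "P = Phi * Q"
    using Phi_dvd_of_root[OF root] by (elim dvdE)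
  also have "\<dots> = Phi * (\<Sum>i\<le>degree Q. monom (coeff Q i) i)"
    by (simp add: poly_as_sum_of_monoms)
  also have "\<dots> = (\<Sum>i\<le>degree Q. \<Sum>j<p. monom (coeff Q i) (i + j * r))"
    by (simp add: Phi_def sum_product mult_monom sum.swap[of _ "{..<p}"] add.commute)
  finally have "lin_ext \<chi> P = (\<Sum>i\<le>degree Q. of_int (coeff Q i) * (\<Sum>j<p. \<chi> (i + j * r)))"
    by (simp add: lin_ext_sum sum_distrib_left)
  thus ?thesis by (simp only: coset) simp
qed

end


section \<open>Cyclotomic integers of absolute value one\<close>

text \<open>
  The quantity \<open>N * \<Sum>d\<^sup>2 - (\<Sum>d)\<^sup>2\<close> is the sum of the squared differences over all pairs of entries, so
  it is invariant under translation of \<open>d\<close>, and one may assume that \<open>S = \<Sum>d\<close> satisfies \<open>0 \<le> S < N\<close>.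
  Since an integer is at most its square, \<open>\<Sum>d\<^sup>2 \<ge> S\<close>. For \<open>S = 0\<close> the bound forces \<open>d = 0\<close>. For
  \<open>S > 0\<close> it forces \<open>\<Sum>d\<^sup>2 = S\<close>, so that all entries are \<open>0\<close> or \<open>1\<close>, and then \<open>S (N - S) \<le> N - 1\<close>
  leaves only \<open>S = 1\<close> and \<open>S = N - 1\<close>.
\<close>

lemma near_constant:
  fixes d :: "'a \<Rightarrow> int"
  assumes A: "finite A" "card A = N" "N \<ge> 2"
    and le: "int N * (\<Sum>x\<in>A. (d x)\<^sup>2) - (\<Sum>x\<in>A. d x)\<^sup>2 \<le> int N - 1"
  obtains (const) e where "\<And>x. x \<in> A \<Longrightarrow> d x = e"
  | (one_off) e y s where "y \<in> A" "s \<in> {1, -1}" "\<And>x. x \<in> A \<Longrightarrow> d x = e + (if x = y then s else 0)"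
proof -
  define e where "e = (\<Sum>x\<in>A. d x) div int N"
  define d' where "d' = (\<lambda>x. d x - e)"
  define S where "S = (\<Sum>x\<in>A. d' x)"
  define T where "T = (\<Sum>x\<in>A. (d' x)\<^sup>2)"
  have d: "d x = d' x + e" for x by (simp add: d'_def)
  have "S = (\<Sum>x\<in>A. d x) - int N * e"
    using A by (simp add: S_def d'_def sum_subtractf)
  hence "S = (\<Sum>x\<in>A. d x) mod int N"
    by (simp add: e_def minus_mult_div_eq_mod)
  hence S: "0 \<le> S" "S < int N" using A by auto
  have "(\<Sum>x\<in>A. d x) = S + int N * e"
    using A by (simp add: S_def d sum.distrib)
  moreover have "(\<Sum>x\<in>A. (d x)\<^sup>2) = T + 2 * e * S + int N * e\<^sup>2"
    using A by (simp add: T_def S_def d power2_sum sum.distrib mult_ac flip: sum_distrib_left sum_distrib_right)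
  ultimately have le': "int N * T - S\<^sup>2 \<le> int N - 1"
    using le by (simp add: algebra_simps power2_eq_square)
  have sq: "i \<le> i\<^sup>2" for i :: int
    by (cases "i \<le> 0") (auto simp: power2_eq_square intro: order_trans[OF _ zero_le_square])
  have "T \<ge> S" unfolding T_def S_def by (intro sum_mono sq)
  show ?thesis
  proof (cases "S = 0")
    case True
    hence "int N * T < int N * 1" using le' by simp
    hence "T < 1" using A by (simp add: mult_less_cancel_left)
    hence "T = 0" using \<open>T \<ge> S\<close> True by simp
    hence "d' x = 0" if "x \<in> A" for x
      using that A by (simp add: T_def sum_nonneg_eq_0_iff)
    thus ?thesis using const[of e] by (simp add: d)
  next
    case False
    have "T = S"
    proof (rule ccontr)
      assume "T \<noteq> S"
      hence "int N * (S + 1) \<le> int N * T" using \<open>T \<ge> S\<close> by (intro mult_left_mono) auto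
      moreover have "S * S \<le> int N * S" using S by (intro mult_right_mono) auto
      ultimately show False using le' by (simp add: algebra_simps power2_eq_square)
    qed
    hence "(\<Sum>x\<in>A. (d' x)\<^sup>2 - d' x) = 0" by (simp add: T_def S_def sum_subtractf)
    hence "(d' x)\<^sup>2 - d' x = 0" if "x \<in> A" for x
      using that A sq by (subst (asm) sum_nonneg_eq_0_iff) auto
    hence d'01: "d' x = 0 \<or> d' x = 1" if "x \<in> A" for x
      using that by (auto simp: power2_eq_square)
    define B where "B = {x \<in> A. d' x = 1}"
    have B: "finite B" "B \<subseteq> A" using A by (auto simp: B_def)
    have "S = (\<Sum>x\<in>B. 1)"
      unfolding S_def B_def using A d'01 by (intro sum.mono_neutral_cong_right) auto
    hence cardB: "S = int (card B)" by simp
    have "(S - 1) * (int N - 1 - S) \<le> 0"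
      using le' \<open>T = S\<close> by (simp add: algebra_simps power2_eq_square)
    hence "S = 1 \<or> S = int N - 1"
      using S False by (auto simp: mult_le_0_iff)
    thus ?thesis
    proof
      assume "S = 1"
      hence "card B = 1" using cardB by simp
      then obtain y where y: "B = {y}" by (rule card_1_singletonE)
      have "d x = e + (if x = y then 1 else 0)" if "x \<in> A" for x
        using y d'01[OF that] that by (auto simp: d B_def)
      moreover have "y \<in> A" using y B by auto
      ultimately show ?thesis using one_off[of y 1 e] by blast
    next
      assume "S = int N - 1"
      hence "card (A - B) = 1" using cardB A B by (simp add: card_Diff_subset)
      then obtain y where y: "A - B = {y}" by (rule card_1_singletonE)
      have "d x = (e + 1) + (if x = y then - 1 else 0)" if "x \<in> A" for x
        using y d'01[OF that] that by (auto simp: d B_def)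
      moreover have "y \<in> A" using y by auto
      ultimately show ?thesis using one_off[of y "-1" "e + 1"] by blast
    qed
  qed
qed

lemma one_off_deviation:
  fixes d :: "'a \<Rightarrow> int"
  assumes A: "finite A" "card A = N" and y: "y \<in> A" "s \<in> {1, -1}"
    and d: "\<And>x. x \<in> A \<Longrightarrow> d x = e + (if x = y then s else 0)"
  shows "int N * (\<Sum>x\<in>A. (d x)\<^sup>2) - (\<Sum>x\<in>A. d x)\<^sup>2 = int N - 1"
proof -
  have "(\<Sum>x\<in>A. d x) = int N * e + s"
    using A y d by (simp add: sum.distrib)
  moreover have "(\<Sum>x\<in>A. (d x)\<^sup>2) = (\<Sum>x\<in>A. e\<^sup>2 + (if x = y then 2 * e * s + s\<^sup>2 else 0))"
    using d by (intro sum.cong) (auto simp: power2_sum)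
  hence "(\<Sum>x\<in>A. (d x)\<^sup>2) = int N * e\<^sup>2 + (2 * e * s + s\<^sup>2)"
    using A y by (simp add: sum.distrib)
  moreover have "s\<^sup>2 = 1" using y by auto
  ultimately show ?thesis by (simp add: algebra_simps power2_eq_square)
qed

lemma deviation_nonneg:
  fixes d :: "'a \<Rightarrow> int"
  assumes "finite A" "card A = N"
  shows "int N * (\<Sum>x\<in>A. (d x)\<^sup>2) - (\<Sum>x\<in>A. d x)\<^sup>2 \<ge> 0"
proof -
  have "(\<Sum>x\<in>A. \<Sum>y\<in>A. (d x - d y)\<^sup>2) \<ge> 0"
    by (intro sum_nonneg) auto
  also have "(\<Sum>x\<in>A. \<Sum>y\<in>A. (d x - d y)\<^sup>2)
      = 2 * (int N * (\<Sum>x\<in>A. (d x)\<^sup>2) - (\<Sum>x\<in>A. d x)\<^sup>2)"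
    using assms
    by (simp add: power2_diff sum.distrib sum_subtractf sum_product power2_eq_square[of "sum d A"]
        sum_distrib_left sum_distrib_right mult_ac)
  finally show ?thesis by simp
qed


context prime_power_cyclotomic
begin

text \<open>The trace of \<open>\<zeta>\<^sup>v\<close> from \<open>\<rat>(\<zeta>)\<close> to \<open>\<rat>\<close> is \<open>p\<^bsup>k-1\<^esup>\<close> times this number.\<close>

definition trace_char :: "nat \<Rightarrow> int" where
  "trace_char v = (if r dvd v then if q dvd v then int p - 1 else - 1 else 0)"

lemma trace_char_coset: "(\<Sum>j<p. trace_char (v + j * r)) = 0"
proof (cases "r dvd v")
  case False
  hence "trace_char (v + j * r) = 0" for j
    by (simp add: trace_char_def dvd_add_left_iff)
  thus ?thesis by simp
next
  case True
  then obtain w where v: "v = r * w" by (elim dvdE)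
  have j: "trace_char (v + j * r) = (if p dvd w + j then int p else 0) - 1" for j
  proof -
    have "v + j * r = r * (w + j)" by (simp add: v algebra_simps)
    thus ?thesis using r_pos by (simp add: trace_char_def q_eq)
  qed
  \<comment> \<open>The only \<open>j < p\<close> with \<open>w + j\<close> divisible by \<open>p\<close>.\<close>
  define j0 where "j0 = (p - w mod p) mod p"
  have "p dvd w + j \<longleftrightarrow> j = j0" if "j < p" for j
  proof -
    have "p dvd w + j \<longleftrightarrow> p dvd w mod p + j"
      by (metis mod_add_left_eq dvd_eq_mod_eq_0)
    also have "\<dots> \<longleftrightarrow> w mod p + j = 0 \<or> w mod p + j = p"
    proof
      assume "p dvd w mod p + j"
      then obtain l where l: "w mod p + j = p * l" by (elim dvdE)
      have "w mod p < p" using p_gt_1 by simp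
      hence "p * l < p * 2" using that l by linarith
      hence "l < 2" by simp
      hence "l = 0 \<or> l = 1" by linarith
      thus "w mod p + j = 0 \<or> w mod p + j = p" using l by auto
    qed auto
    also have "\<dots> \<longleftrightarrow> j = j0"
    proof (cases "w mod p = 0")
      case True
      thus ?thesis using that by (auto simp: j0_def)
    next
      case False
      hence "j0 = p - w mod p" using p_gt_1 by (simp add: j0_def)
      moreover have "w mod p < p" using p_gt_1 by simp
      ultimately show ?thesis using False by auto
    qed
    finally show ?thesis .
  qed
  hence "(\<Sum>j<p. trace_char (v + j * r)) = (\<Sum>j<p. (if j = j0 then int p else 0) - 1)"
    unfolding j by (intro sum.cong) auto
  also have "\<dots> = 0"
    using p_gt_1 by (simp add: sum_subtractf j0_def)
  finally show ?thesis .
qed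

text \<open>Exponents modulo \<open>p\<^sup>k\<close> are split into a residue modulo \<open>p\<^bsup>k-1\<^esup>\<close> and a leading digit.\<close>

lemma cyc_ints_expansion:
  assumes "b \<in> R"
  obtains c :: "nat \<Rightarrow> nat \<Rightarrow> int" where "b = (\<Sum>x<r. \<Sum>i<p. of_int (c x i) * z ^ (x + r * i))"
proof -
  obtain P where b: "b = poly (of_int_poly P) z"
    using assms by (auto simp: cyc_ints_def)
  define h where "h = (\<lambda>e. (e mod r, (e div r) mod p))"
  define c where "c = (\<lambda>x i. \<Sum>e\<in>{e. e \<in> {..degree P} \<and> h e = (x, i)}. coeff P e)"
  have pow: "z ^ e = z ^ (e mod r + r * ((e div r) mod p))" for e
  proof -
    have "e mod q = r * ((e div r) mod p) + e mod r"
      unfolding q_eq by (rule mod_mult2_eq)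
    thus ?thesis using zeta_pow_mod[OF q_pos, of e] by (simp add: add.commute)
  qed
  have "(\<Sum>x<r. \<Sum>i<p. of_int (c x i) * z ^ (x + r * i))
      = (\<Sum>y\<in>{..<r} \<times> {..<p}. of_int (c (fst y) (snd y)) * z ^ (fst y + r * snd y))"
    by (simp add: sum.cartesian_product case_prod_unfold)
  also have "\<dots> = (\<Sum>y\<in>{..<r} \<times> {..<p}. \<Sum>e\<in>{e. e \<in> {..degree P} \<and> h e = y}. of_int (coeff P e) * z ^ e)"
  proof (intro sum.cong refl)
    fix y assume "y \<in> {..<r} \<times> {..<p}"
    have "of_int (c (fst y) (snd y)) * z ^ (fst y + r * snd y)
        = (\<Sum>e\<in>{e. e \<in> {..degree P} \<and> h e = y}. of_int (coeff P e) * z ^ (fst y + r * snd y))"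
      by (simp add: c_def sum_distrib_right)
    also have "\<dots> = (\<Sum>e\<in>{e. e \<in> {..degree P} \<and> h e = y}. of_int (coeff P e) * z ^ e)"
      by (intro sum.cong refl) (subst (2) pow, auto simp: h_def)
    finally show "of_int (c (fst y) (snd y)) * z ^ (fst y + r * snd y)
        = (\<Sum>e\<in>{e. e \<in> {..degree P} \<and> h e = y}. of_int (coeff P e) * z ^ e)" .
  qed
  also have "\<dots> = (\<Sum>e\<le>degree P. of_int (coeff P e) * z ^ e)"
    by (rule sum.group) (use r_pos p_gt_1 in \<open>auto simp: h_def\<close>)
  also have "\<dots> = b"
    by (simp add: b poly_altdef)
  finally show ?thesis using that[of c] by simp
qed

text \<open>
  Adding \<open>p\<^sup>k\<close> makes the truncated difference of two exponents a true difference modulo \<open>p\<^sup>k\<close>.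
\<close>

lemma trace_char_difference:
  assumes "x < r" "y < r" "i < p" "j < p"
  shows "trace_char (x + r * i + (q - (y + r * j)))
    = (if x = y then if i = j then int p - 1 else - 1 else 0)"
proof -
  have lt: "y + r * j < q"
  proof -
    have "y + r * j < r * (j + 1)" using assms by simp
    also have "\<dots> \<le> r * p" using assms by (intro mult_le_mono) auto
    finally show ?thesis by (simp add: q_eq)
  qed
  have dvd: "m dvd x + r * i + (q - (y + r * j)) \<longleftrightarrow> [x + r * i = y + r * j] (mod m)"
    if "m dvd q" for m
  proof -
    have "m dvd x + r * i + (q - (y + r * j))
      \<longleftrightarrow> int m dvd int (x + r * i + (q - (y + r * j)))" by (simp only: int_dvd_int_iff)
    also have "int (x + r * i + (q - (y + r * j))) = (int (x + r * i) - int (y + r * j)) + int q"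
      using lt by simp
    also have "int m dvd \<dots> \<longleftrightarrow> int m dvd int (x + r * i) - int (y + r * j)"
      using that by (intro dvd_add_left_iff) (simp only: int_dvd_int_iff)
    finally show ?thesis by (simp only: cong_iff_dvd_diff flip: cong_int_iff)
  qed
  have lt': "x + r * i < q"
  proof -
    have "x + r * i < r * (i + 1)" using assms by simp
    also have "\<dots> \<le> r * p" using assms by (intro mult_le_mono) auto
    finally show ?thesis by (simp add: q_eq)
  qed
  have "r dvd x + r * i + (q - (y + r * j)) \<longleftrightarrow> x = y"
    by (subst dvd) (use assms in \<open>auto simp: q_eq cong_def\<close>)
  moreover have "q dvd x + r * i + (q - (y + r * j)) \<longleftrightarrow> x = y \<and> i = j"
  proof -
    have "q dvd x + r * i + (q - (y + r * j)) \<longleftrightarrow> x + r * i = y + r * j"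
      by (subst dvd) (use lt lt' in \<open>auto simp: cong_def\<close>)
    also have "\<dots> \<longleftrightarrow> x = y \<and> i = j"
    proof
      assume eq: "x + r * i = y + r * j"
      hence "(x + r * i) mod r = (y + r * j) mod r" by simp
      hence "x = y" using assms by simp
      moreover have "r * i = r * j" using eq \<open>x = y\<close> by simp
      hence "i = j" using r_pos by (metis mult_cancel1 less_numeral_extra(3))
      ultimately show "x = y \<and> i = j" by blast
    qed auto
    finally show ?thesis .
  qed
  ultimately show ?thesis by (auto simp: trace_char_def)
qed

text \<open>
  The trace of \<open>1\<close> is compared with the trace of \<open>b * cnj b\<close>, a quadratic form in the coefficients
  of \<open>b\<close> in which residue classes modulo \<open>p\<^bsup>k-1\<^esup>\<close> do not interact.
\<close>

lemma trace_norm_identity: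
  fixes c :: "nat \<Rightarrow> nat \<Rightarrow> int"
  assumes b: "b = (\<Sum>x<r. \<Sum>i<p. of_int (c x i) * z ^ (x + r * i))" and nrm: "b * cnj b = 1"
  shows "(\<Sum>x<r. int p * (\<Sum>i<p. (c x i)\<^sup>2) - (\<Sum>i<p. c x i)\<^sup>2) = int p - 1"
proof -
  define P where "P = (\<Sum>x<r. \<Sum>i<p. \<Sum>y<r. \<Sum>j<p.
      monom (c x i * c y j) (x + r * i + (q - (y + r * j))))"
  have cnjb: "cnj b = (\<Sum>y<r. \<Sum>j<p. of_int (c y j) * z ^ (q - (y + r * j)))"
  proof -
    have "cnj (z ^ (y + r * j)) = z ^ (q - (y + r * j))" if "y < r" "j < p" for y j
    proof -
      have "y + r * j < r * (j + 1)" using that by simp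
      also have "\<dots> \<le> r * p" using that by (intro mult_le_mono) auto
      finally have "y + r * j < q" by (simp add: q_eq)
      hence "z ^ (y + r * j) * z ^ (q - (y + r * j)) = 1"
        using zeta_pow_self[OF q_pos] by (simp flip: power_add)
      hence "inverse (z ^ (y + r * j)) = z ^ (q - (y + r * j))"
        by (rule inverse_unique)
      thus ?thesis by (simp add: cnj_zeta power_inverse)
    qed
    thus ?thesis by (simp add: b)
  qed
  have "poly (of_int_poly P) z = (\<Sum>x<r. \<Sum>i<p. \<Sum>y<r. \<Sum>j<p.
      of_int (c x i) * z ^ (x + r * i) * (of_int (c y j) * z ^ (q - (y + r * j))))"
    by (simp add: P_def of_int_poly_hom.hom_sum poly_sum poly_monom power_add mult_ac)
  also have "\<dots> = b * cnj b"
    unfolding cnjb by (subst b, simp only: sum_distrib_right, simp only: sum_distrib_left)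
  finally have "poly (of_int_poly (P - monom 1 0)) z = 0"
    by (simp add: nrm of_int_poly_hom.hom_minus poly_monom)
  moreover have "(\<Sum>j<p. of_int (trace_char (v + j * r))) = (0 :: complex)" for v
    by (metis of_int_sum of_int_0 trace_char_coset)
  ultimately have "lin_ext (\<lambda>v. of_int (trace_char v)) (P - monom 1 0) = 0"
    by (intro lin_ext_eq_0)
  hence "lin_ext (\<lambda>v. of_int (trace_char v)) P = of_int (int p - 1)"
    by (simp only: lin_ext_diff lin_ext_monom) (simp add: trace_char_def)
  also have "lin_ext (\<lambda>v. of_int (trace_char v)) P = of_int (\<Sum>x<r. \<Sum>i<p. \<Sum>y<r. \<Sum>j<p.
      c x i * c y j * trace_char (x + r * i + (q - (y + r * j))))"
    by (simp only: P_def lin_ext_sum lin_ext_monom of_int_sum of_int_mult)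
  finally have "int p - 1 = (\<Sum>x<r. \<Sum>i<p. \<Sum>y<r. \<Sum>j<p.
      c x i * c y j * trace_char (x + r * i + (q - (y + r * j))))"
    by (simp only: of_int_eq_iff)
  also have "\<dots> = (\<Sum>x<r. \<Sum>i<p. \<Sum>j<p. c x i * c x j * (if i = j then int p - 1 else - 1))"
  proof (rule sum.cong[OF refl], rule sum.cong[OF refl])
    fix x i assume x: "x \<in> {..<r}" and i: "i \<in> {..<p}"
    let ?t = "\<Sum>j<p. c x i * c x j * (if i = j then int p - 1 else - 1)"
    have "(\<Sum>j<p. c x i * c y j * trace_char (x + r * i + (q - (y + r * j)))) = (if y = x then ?t else 0)"
      if "y \<in> {..<r}" for y
    proof -
      have "(\<Sum>j<p. c x i * c y j * trace_char (x + r * i + (q - (y + r * j))))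
        = (\<Sum>j<p. c x i * c y j * (if x = y then if i = j then int p - 1 else - 1 else 0))"
        using x i that by (intro sum.cong refl) (subst trace_char_difference, auto)
      thus ?thesis by auto
    qed
    hence "(\<Sum>y<r. \<Sum>j<p. c x i * c y j * trace_char (x + r * i + (q - (y + r * j))))
      = (\<Sum>y<r. if y = x then ?t else 0)"
      by (intro sum.cong refl) blast
    also have "\<dots> = ?t" using x by (subst sum.delta) auto
    finally show "(\<Sum>y<r. \<Sum>j<p. c x i * c y j * trace_char (x + r * i + (q - (y + r * j)))) = ?t" .
  qed
  also have "\<dots> = (\<Sum>x<r. \<Sum>i<p. \<Sum>j<p. (if i = j then int p * (c x i)\<^sup>2 else 0) - c x i * c x j)"
    by (intro sum.cong refl) (auto simp: algebra_simps power2_eq_square)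
  also have "\<dots> = (\<Sum>x<r. int p * (\<Sum>i<p. (c x i)\<^sup>2) - (\<Sum>i<p. c x i)\<^sup>2)"
    unfolding power2_eq_square[of "sum _ _"] sum_product by (simp add: sum_subtractf sum_distrib_left)
  finally show ?thesis by simp
qed

text \<open>
  A form of Kronecker's theorem. The classes of exponents modulo \<open>p\<^bsup>k-1\<^esup>\<close> contribute nonnegative terms
  with sum \<open>p - 1\<close> to the trace form. A class with constant coefficients contributes nothing to \<open>b\<close>,
  and any other class has a term of at least \<open>p - 1\<close>, with equality only if its coefficients are
  constant up to \<open>\<plusminus>1\<close> at one exponent. Hence exactly one class is of the second kind, and \<open>b\<close> is \<open>\<plusminus>\<close>
  the power of \<open>\<zeta>\<close> with that exponent.
\<close>

lemma unit_norm_imp_root_of_unity: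
  assumes "b \<in> R" and nrm: "b * cnj b = 1"
  obtains s :: int and m where "s \<in> {1, -1}" "b = of_int s * z ^ m"
proof -
  obtain c where b: "b = (\<Sum>x<r. \<Sum>i<p. of_int (c x i) * z ^ (x + r * i))"
    using cyc_ints_expansion[OF assms(1)] by blast
  define D where "D = (\<lambda>x. int p * (\<Sum>i<p. (c x i)\<^sup>2) - (\<Sum>i<p. c x i)\<^sup>2)"
  define B where "B = (\<lambda>x. \<Sum>i<p. of_int (c x i) * z ^ (x + r * i))"
  have sumD: "(\<Sum>x<r. D x) = int p - 1"
    using trace_norm_identity[OF b nrm] by (simp add: D_def)
  have D0: "D x \<ge> 0" for x
    unfolding D_def by (rule deviation_nonneg) auto
  have Dle: "D x \<le> int p - 1" if "x < r" for x
    using member_le_sum[of x "{..<r}" D] that D0 sumD by simp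
  have cases: "B x = 0 \<or> (D x = int p - 1 \<and> (\<exists>s m. s \<in> {1, -1 :: int} \<and> B x = of_int s * z ^ m))"
    if "x < r" for x
  proof -
    have zero: "(\<Sum>i<p. z ^ (x + r * i)) = 0"
    proof -
      have "(\<Sum>i<p. z ^ (x + r * i)) = z ^ x * poly (of_int_poly Phi) z"
        by (simp add: poly_Phi sum_distrib_left power_add power_mult)
      thus ?thesis by (simp add: Phi_z)
    qed
    have le: "int p * (\<Sum>i<p. (c x i)\<^sup>2) - (\<Sum>i<p. c x i)\<^sup>2 \<le> int p - 1"
      using Dle[OF that] by (simp add: D_def)
    have "p \<ge> 2" using p_gt_1 by simp
    show ?thesis
    proof (rule near_constant[OF finite_lessThan card_lessThan \<open>p \<ge> 2\<close> le])
      fix e assume const: "\<And>i. i \<in> {..<p} \<Longrightarrow> c x i = e"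
      have "B x = of_int e * (\<Sum>i<p. z ^ (x + r * i))"
        unfolding B_def sum_distrib_left using const by (intro sum.cong) auto
      thus ?thesis unfolding zero by simp
    next
      fix e y s
      assume one_off: "y \<in> {..<p}" "s \<in> {1, -1 :: int}"
        "\<And>i. i \<in> {..<p} \<Longrightarrow> c x i = e + (if i = y then s else 0)"
      have "D x = int p - 1"
        unfolding D_def by (rule one_off_deviation[OF _ _ one_off]) auto
      moreover have "B x = (\<Sum>i<p. of_int e * z ^ (x + r * i) + (if i = y then of_int s * z ^ (x + r * i) else 0))"
        unfolding B_def using one_off by (intro sum.cong) (auto simp: algebra_simps)
      hence "B x = of_int e * (\<Sum>i<p. z ^ (x + r * i)) + of_int s * z ^ (x + r * y)"
        using one_off by (simp add: sum.distrib flip: sum_distrib_left)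
      ultimately show ?thesis using one_off(2) zero by auto
    qed
  qed
  have "b = (\<Sum>x<r. B x)" by (simp add: b B_def)
  moreover have "b \<noteq> 0" using nrm by auto
  ultimately obtain x where x: "x < r" "B x \<noteq> 0"
    by (metis lessThan_iff sum.neutral)
  then obtain s m where sm: "s \<in> {1, -1 :: int}" "B x = of_int s * z ^ m" and Dx: "D x = int p - 1"
    using cases by blast
  have "(\<Sum>y<r. D y) = D x + (\<Sum>y\<in>{..<r} - {x}. D y)"
    using x by (intro sum.remove) auto
  hence "(\<Sum>y\<in>{..<r} - {x}. D y) = 0" using sumD Dx by simp
  hence "D y = 0" if "y < r" "y \<noteq> x" for y
    using that D0 by (subst (asm) sum_nonneg_eq_0_iff) auto
  hence "B y = 0" if "y < r" "y \<noteq> x" for y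
    using that cases[of y] p_gt_1 by auto
  hence "(\<Sum>y<r. B y) = B x"
    using x by (subst sum.remove[of _ x]) auto
  hence "b = of_int s * z ^ m" using \<open>b = (\<Sum>x<r. B x)\<close> sm(2) by simp
  with sm(1) show ?thesis by (rule that)
qed

end


section \<open>A square root of a prime up to sign\<close>

text \<open>
  Up to sign, this is the quadratic Gauss sum. Its square is whichever of \<open>p\<close> and \<open>-p\<close> is congruent
  to \<open>1\<close> modulo \<open>4\<close>.
\<close>

definition gauss_root :: "nat \<Rightarrow> complex" where
  "gauss_root p = (\<Prod>i=1..(p - 1) div 2. zeta p ^ i - inverse (zeta p ^ i))"

lemma cnj_gauss_root: "cnj (gauss_root p) = (- 1) ^ ((p - 1) div 2) * gauss_root p"
proof -
  have "cnj (gauss_root p) = (\<Prod>i=1..(p - 1) div 2. - 1 * (zeta p ^ i - inverse (zeta p ^ i)))"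
    unfolding gauss_root_def by (simp add: cnj_zeta power_inverse)
  thus ?thesis
    unfolding prod.distrib by (simp add: gauss_root_def)
qed

lemma gauss_root_in_cyc_ints: "p > 0 \<Longrightarrow> gauss_root p \<in> cyc_ints p"
  unfolding gauss_root_def using cyc_ints_inverse_zeta
  by (intro cyc_ints_prod cyc_ints_diff) (auto simp flip: power_inverse)

text \<open>
  The factor with index \<open>i\<close> has the squared modulus \<open>(1 - \<zeta>\<^bsup>2i\<^esup>) (1 - \<zeta>\<^bsup>p-2i\<^esup>)\<close>. The exponents \<open>2i\<close> and
  \<open>p - 2i\<close> run through the even and the odd nonzero residues, so the product over \<open>i\<close> is the value at
  \<open>1\<close> of the cyclotomic polynomial of order \<open>p\<close>.
\<close>

lemma gauss_root_norm:
  assumes "prime p" "odd p"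
  shows "gauss_root p * cnj (gauss_root p) = of_nat p"
proof -
  interpret prime_power_cyclotomic p 1
    using assms by unfold_locales auto
  define h where "h = (p - 1) div 2"
  have p: "p = 2 * h + 1" using assms by (auto simp: h_def elim: oddE)
  have inv: "inverse (zeta p ^ i) = zeta p ^ (p - i)" if "i \<le> p" for i
  proof (rule inverse_unique)
    show "zeta p ^ i * zeta p ^ (p - i) = 1"
      using that zeta_pow_self[of p] p_gt_1 by (simp flip: power_add)
  qed
  have "gauss_root p * cnj (gauss_root p)
      = (\<Prod>i=1..h. (zeta p ^ i - inverse (zeta p ^ i)) * (inverse (zeta p ^ i) - zeta p ^ i))"
    unfolding gauss_root_def prod.distrib h_def by (simp add: cnj_zeta power_inverse)
  also have "\<dots> = (\<Prod>i=1..h. (1 - zeta p ^ (2 * i)) * (1 - zeta p ^ (p - 2 * i)))"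
  proof (intro prod.cong refl)
    fix i
    define w where "w = zeta p ^ i"
    assume "i \<in> {1..h}"
    hence "zeta p ^ (p - 2 * i) = inverse (zeta p ^ (2 * i))" using inv p by simp
    moreover have "zeta p ^ (2 * i) = w * w" by (simp add: w_def mult_2 power_add)
    moreover have "(w - inverse w) * (inverse w - w) = (1 - w * w) * (1 - inverse (w * w))"
      by (simp add: w_def field_simps)
    ultimately show "(zeta p ^ i - inverse (zeta p ^ i)) * (inverse (zeta p ^ i) - zeta p ^ i)
      = (1 - zeta p ^ (2 * i)) * (1 - zeta p ^ (p - 2 * i))"
      by (simp add: w_def)
  qed
  also have "\<dots> = (\<Prod>a\<in>(\<lambda>i. 2 * i) ` {1..h}. 1 - zeta p ^ a) * (\<Prod>a\<in>(\<lambda>i. p - 2 * i) ` {1..h}. 1 - zeta p ^ a)"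
    unfolding prod.distrib using p
    by (subst (1 2) prod.reindex) (auto simp: inj_on_def)
  also have "\<dots> = (\<Prod>a\<in>(\<lambda>i. 2 * i) ` {1..h} \<union> (\<lambda>i. p - 2 * i) ` {1..h}. 1 - zeta p ^ a)"
    using p by (intro prod.union_disjoint [symmetric]) (auto, presburger)
  also have "(\<lambda>i. 2 * i) ` {1..h} \<union> (\<lambda>i. p - 2 * i) ` {1..h} = totatives p"
  proof (intro equalityI subsetI)
    fix a assume "a \<in> totatives p"
    hence a: "0 < a" "a < p"
      using p_gt_1 by (auto simp: totatives_def le_less)
    show "a \<in> (\<lambda>i. 2 * i) ` {1..h} \<union> (\<lambda>i. p - 2 * i) ` {1..h}"
    proof (cases "even a")
      case True
      thus ?thesis using a p by (auto elim!: evenE)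
    next
      case False
      then obtain l where "a = 2 * l + 1" by (elim oddE)
      hence "a = p - 2 * (h - l)" "h - l \<in> {1..h}" using a p by auto
      thus ?thesis by blast
    qed
  next
    fix a assume "a \<in> (\<lambda>i. 2 * i) ` {1..h} \<union> (\<lambda>i. p - 2 * i) ` {1..h}"
    hence "0 < a" "a < p" using p by auto
    thus "a \<in> totatives p"
      using assms by (auto simp: totatives_prime)
  qed
  also have "(\<Prod>a\<in>totatives p. 1 - zeta p ^ a) = of_nat p"
    using prod_one_minus by simp
  finally show ?thesis .
qed


text \<open>
  The quotient of the Gauss sum by \<open>\<surd>p\<close> has modulus one, and it is real or purely imaginary
  according to the residue of \<open>p\<close> modulo \<open>4\<close>.
\<close>

lemma gauss_root_normalized:
  assumes "prime p" "odd p"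
  obtains \<epsilon> where "\<epsilon> \<in> {1, - 1 :: complex}"
    "of_real (real p powr (- real n / 2)) * gauss_root p ^ n =
      (if even n \<or> (odd n \<and> [p = 1] (mod 4)) then \<epsilon> else \<epsilon> * \<i>)"
proof -
  have p: "p > 0" using assms prime_gt_0_nat by blast
  define h where "h = (p - 1) div 2"
  define \<gamma> where "\<gamma> = gauss_root p / of_real (sqrt (real p))"
  have h: "p = 2 * h + 1" using assms by (auto simp: h_def elim: oddE)
  have sq: "(of_real (sqrt (real p)) :: complex) * of_real (sqrt (real p)) = of_nat p"
    by (simp flip: of_real_mult)
  have "\<gamma> * cnj \<gamma> = 1"
    using gauss_root_norm[OF assms] p by (simp add: \<gamma>_def sq)
  moreover have "cnj \<gamma> = (- 1) ^ h * \<gamma>"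
    by (simp add: \<gamma>_def cnj_gauss_root h_def)
  ultimately have g: "(- 1) ^ h * (\<gamma> * \<gamma>) = 1"
    by (simp add: mult_ac)
  have "real p powr (- real n / 2) = (1 / sqrt (real p)) ^ n"
  proof -
    have "(1 / sqrt (real p)) ^ n = (real p powr (- 1 / 2)) ^ n"
      using p by (simp add: powr_minus powr_half_sqrt field_simps)
    also have "\<dots> = real p powr (- real n / 2)"
      using p by (simp add: powr_power)
    finally show ?thesis by simp
  qed
  hence lhs: "of_real (real p powr (- real n / 2)) * gauss_root p ^ n = \<gamma> ^ n"
    by (simp add: \<gamma>_def power_divide)
  have pm: "x ^ i \<in> {1, - 1}" if "x \<in> {1, - 1}" for x :: complex and i
    using that by (induction i) auto
  show ?thesis
  proof (cases "even n")
    case True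
    then obtain i where i: "n = 2 * i" by (elim evenE)
    have "\<gamma> * \<gamma> \<in> {1, - 1}"
      using g by (cases "even h") (auto simp: minus_equation_iff)
    hence "\<gamma> ^ n \<in> {1, - 1}"
      using pm by (simp add: i power_mult power2_eq_square)
    thus ?thesis using that[of "\<gamma> ^ n"] True lhs by simp
  next
    case False
    show ?thesis
    proof (cases "even h")
      case True
      hence "[p = 1] (mod 4)" using h by (auto simp: cong_def elim!: evenE)
      have "\<gamma> * \<gamma> = 1" using g True by simp
      hence "\<gamma> \<in> {1, - 1}" by (simp add: square_eq_1_iff)
      hence "\<gamma> ^ n \<in> {1, - 1}" by (rule pm)
      thus ?thesis using that[of "\<gamma> ^ n"] False lhs \<open>[p = 1] (mod 4)\<close> by simp
    next
      case odd: False
      hence "\<not> [p = 1] (mod 4)" using h by (auto simp: cong_def elim!: oddE)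
      obtain i where i: "n = 2 * i + 1" using False by (elim oddE)
      have g2: "\<gamma> * \<gamma> = - 1" using g odd by (simp add: minus_equation_iff)
      have "(\<gamma> / \<i>) * (\<gamma> / \<i>) = \<gamma> * \<gamma> / (\<i> * \<i>)" by (simp only: times_divide_times_eq)
      also have "\<dots> = 1" unfolding g2 by simp
      finally have "\<gamma> / \<i> \<in> {1, - 1}" by (simp only: square_eq_1_iff insert_iff empty_iff) simp
      moreover have "(\<gamma> ^ 2) ^ i \<in> {1, - 1}"
        by (rule pm) (simp add: g2 power2_eq_square)
      ultimately have "(\<gamma> / \<i>) * (\<gamma> ^ 2) ^ i \<in> {1, - 1}" by auto
      moreover have "(\<gamma> / b) * y * b = y * \<gamma>" if "b \<noteq> 0" for b y
        using that by simp
      hence "\<gamma> ^ n = (\<gamma> / \<i>) * (\<gamma> ^ 2) ^ i * \<i>"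
        unfolding i power_add power_mult using complex_i_not_zero by (metis power_one_right)
      ultimately show ?thesis
        using that[of "(\<gamma> / \<i>) * (\<gamma> ^ 2) ^ i"] False lhs \<open>\<not> [p = 1] (mod 4)\<close> by simp
    qed
  qed
qed

section \<open>Cyclotomic integers whose norm is a power of a prime\<close>

context prime_power_cyclotomic
begin

lemma cyc_ints_zeta_p_subset: "cyc_ints p \<subseteq> R"
  unfolding cyc_ints_def[of p] z_pow_r[symmetric] by auto

text \<open>
  For \<open>G = gauss_root p\<close>, the number \<open>v = w * cnj G ^ n\<close> has the norm \<open>p\<^bsup>2n\<^esup>\<close>, an even power of \<open>p\<close>, so
  \<open>v / p\<^sup>n\<close> is a cyclotomic integer of absolute value one; it equals \<open>w / G\<^sup>n\<close>.
\<close>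

lemma norm_p_power_imp_gauss_root_power:
  assumes odd: "odd p" and w: "w \<in> R" and nrm: "w * cnj w = of_nat p ^ n"
  obtains \<sigma> :: int and m where "\<sigma> \<in> {1, - 1}" "m < q" "w = of_int \<sigma> * z ^ m * gauss_root p ^ n"
proof -
  let ?G = "gauss_root p"
  have GR: "?G \<in> R"
    using gauss_root_in_cyc_ints cyc_ints_zeta_p_subset p_gt_1 by auto
  have G: "?G * cnj ?G = of_nat p"
    by (rule gauss_root_norm[OF prime_p odd])
  define v where "v = w * cnj ?G ^ n"
  have vR: "v \<in> R"
    unfolding v_def using w GR q_pos by (intro cyc_ints_mult cyc_ints_power cyc_ints_cnj)
  have "v * cnj v = (w * cnj w) * (?G * cnj ?G) ^ n"
    by (simp add: v_def power_mult_distrib mult_ac)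
  also have "\<dots> = of_nat p ^ (2 * n)"
    by (simp add: nrm G mult_2 power_add)
  finally have vn: "v * cnj v = of_nat p ^ (2 * n)" .
  have "v / of_nat p ^ n * cnj (v / of_nat p ^ n) = 1"
    using vn p_gt_1 by (simp add: mult_2 power_add)
  then obtain \<sigma> m where \<sigma>: "\<sigma> \<in> {1, - 1 :: int}" and v: "v / of_nat p ^ n = of_int \<sigma> * z ^ m"
    using unit_norm_imp_root_of_unity[OF div_p_pow_of_norm[OF vR vn]] by blast
  have "w * of_nat p ^ n = v * ?G ^ n"
    by (simp add: v_def power_mult_distrib mult_ac flip: G)
  also have "v = of_int \<sigma> * z ^ m * of_nat p ^ n"
    using v p_gt_1 by (simp add: field_simps)
  finally have "w = of_int \<sigma> * z ^ (m mod q) * ?G ^ n"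
    using p_gt_1 by (simp add: zeta_pow_mod[OF q_pos])
  moreover have "m mod q < q" using q_pos by simp
  ultimately show ?thesis using that \<sigma> by blast
qed

text \<open>
  The \<open>\<int>[\<zeta>\<^sub>p]\<close>-linear map on \<open>\<int>[\<zeta>]\<close> with \<open>\<zeta>\<^sup>v \<mapsto> \<chi> v\<close> is applied to both sides of an equation. It is
  well defined because the sum of \<open>\<chi>\<close> over a coset \<open>v + p\<^bsup>k-1\<^esup> j\<close>, \<open>j < p\<close>, is \<open>\<chi> v\<close> times the sum of all
  \<open>p\<close>-th roots of unity.
\<close>

lemma transfer_sum_of_powers:
  fixes \<chi> :: "nat \<Rightarrow> complex" and h :: "'a \<Rightarrow> int" and e :: "'a \<Rightarrow> nat"
  assumes \<chi>: "\<And>v. \<chi> (v + r) = zeta p * \<chi> v" and g: "g \<in> cyc_ints p"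
    and eq: "(\<Sum>x\<in>X. zeta p powi h x * z ^ e x) = of_int \<sigma> * z ^ m * g"
  shows "(\<Sum>x\<in>X. zeta p powi h x * \<chi> (e x)) = of_int \<sigma> * \<chi> m * g"
proof -
  have \<chi>_add: "\<chi> (v + r * l) = zeta p ^ l * \<chi> v" for v l
  proof (induction l)
    case (Suc l)
    have "v + r * Suc l = (v + r * l) + r" by simp
    thus ?case using Suc \<chi>[of "v + r * l"] by (simp only: power_Suc mult.assoc)
  qed simp
  have zp: "zeta p ^ l = z ^ (r * l)" for l
    by (metis power_mult z_pow_r)
  define l where "l = (\<lambda>x. nat (h x mod int p))"
  have l: "zeta p powi h x = zeta p ^ l x" for x
  proof -
    have "zeta p powi h x = zeta p powi (h x mod int p)"
      using zeta_powi_mod p_gt_1 by simp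
    also have "h x mod int p = int (l x)" using p_gt_1 by (simp add: l_def)
    finally show ?thesis by simp
  qed
  obtain Q where Q: "g = poly (of_int_poly Q) (zeta p)"
    using g by (auto simp: cyc_ints_def)
  hence g_sum: "g = (\<Sum>i\<le>degree Q. of_int (coeff Q i) * zeta p ^ i)"
    by (simp add: poly_altdef)
  define P where "P = (\<Sum>x\<in>X. monom 1 (e x + r * l x))
    - (\<Sum>i\<le>degree Q. monom (\<sigma> * coeff Q i) (m + r * i))"
  have "poly (of_int_poly P) z = (\<Sum>x\<in>X. zeta p powi h x * z ^ e x) - of_int \<sigma> * z ^ m * g"
    by (simp add: P_def of_int_poly_hom.hom_sum of_int_poly_hom.hom_minus poly_sum poly_monom l zp
        g_sum power_add sum_distrib_left mult_ac)
  hence "poly (of_int_poly P) z = 0" using eq by simp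
  moreover have "(\<Sum>j<p. \<chi> (v + j * r)) = 0" for v
  proof -
    have "(\<Sum>j<p. \<chi> (v + j * r)) = poly (of_int_poly Phi) z * \<chi> v"
      unfolding poly_Phi z_pow_r sum_distrib_right mult.commute[of _ r] \<chi>_add ..
    thus ?thesis by (simp add: Phi_z)
  qed
  ultimately have "lin_ext \<chi> P = 0" by (intro lin_ext_eq_0)
  moreover have "lin_ext \<chi> P = (\<Sum>x\<in>X. zeta p powi h x * \<chi> (e x)) - of_int \<sigma> * \<chi> m * g"
    unfolding P_def lin_ext_diff lin_ext_sum lin_ext_monom \<chi>_add l g_sum sum_distrib_left
    by (simp add: mult_ac)
  ultimately show ?thesis by simp
qed

end

section \<open>Fourier inversion on a finite module\<close>

lemma Zmod_eq: "m > 0 \<Longrightarrow> Zmod m = {0..<int m}"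
  by (auto simp: Zmod_def residue_ring_def)

lemma Zvec_mem:
  assumes "m > 0"
  shows "x \<in> Zvec m l \<longleftrightarrow> x \<in> {1..l} \<rightarrow>\<^sub>E {0..<int m}"
  by (simp add: Zvec_def Zmod_eq[OF assms])

lemma finite_Zvec: "m > 0 \<Longrightarrow> finite (Zvec m l)"
  by (simp add: Zvec_def Zmod_eq finite_PiE)

lemma sum_zeta_powi:
  assumes "m > 0"
  shows "(\<Sum>c\<in>Zmod m. zeta m powi (c * e)) = (if int m dvd e then of_nat m else 0)"
proof -
  have "Zmod m = int ` {..<m}"
    using assms by (simp add: Zmod_eq image_int_atLeastLessThan lessThan_atLeast0)
  hence "(\<Sum>c\<in>Zmod m. zeta m powi (c * e)) = (\<Sum>c<m. zeta m powi (int c * e))"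
    by (simp add: sum.reindex)
  also have "\<dots> = (\<Sum>c<m. (zeta m powi e) ^ c)"
    by (simp add: power_int_mult mult.commute)
  also have "\<dots> = (if int m dvd e then of_nat m else 0)"
  proof (cases "int m dvd e")
    case True
    hence "zeta m powi e = 1" using zeta_powi_mod[OF assms, of e] by simp
    thus ?thesis using True by simp
  next
    case False
    have "zeta m powi e = zeta m ^ nat (e mod int m)"
    proof -
      have "zeta m powi e = zeta m powi int (nat (e mod int m))"
        using zeta_powi_mod[OF assms, of e] assms by simp
      thus ?thesis by (simp only: power_int_of_nat)
    qed
    moreover have "\<not> m dvd nat (e mod int m)"
    proof
      assume "m dvd nat (e mod int m)"
      hence "int m dvd int (nat (e mod int m))" by (simp only: int_dvd_int_iff)
      hence "int m dvd e" using assms by (simp add: dvd_mod_iff)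
      thus False using False by contradiction
    qed
    ultimately have "zeta m powi e \<noteq> 1"
      using zeta_pow_eq_1_iff[OF assms] by simp
    moreover have "(zeta m powi e) ^ m = zeta m powi (int m * e)"
      by (metis power_int_mult power_int_of_nat mult.commute)
    hence "(zeta m powi e) ^ m = 1"
      using assms by (simp add: zeta_pow_self power_int_mult)
    ultimately show ?thesis using False by (simp add: sum_gp_strict)
  qed
  finally show ?thesis .
qed

lemma character_orthogonality:
  assumes m: "m > 0" and b: "b \<in> Zvec m l" and d: "d \<in> Zvec m l"
  shows "(\<Sum>c\<in>Zvec m l. zeta m powi (\<Sum>i=1..l. c i * (b i - d i))) = (if b = d then of_nat m ^ l else 0)"
proof -
  have pow_sum: "zeta m powi (\<Sum>i\<in>A. h i) = (\<Prod>i\<in>A. zeta m powi h i)" for A :: "nat set" and h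
    by (induction A rule: infinite_finite_induct) (auto simp: power_int_add)
  have "(\<Sum>c\<in>Zvec m l. zeta m powi (\<Sum>i=1..l. c i * (b i - d i)))
      = (\<Prod>i=1..l. \<Sum>c\<in>Zmod m. zeta m powi (c * (b i - d i)))"
    unfolding Zvec_def pow_sum using m by (intro prod_sum_PiE [symmetric]) (auto simp: Zmod_eq)
  also have "\<dots> = (\<Prod>i=1..l. if b i = d i then of_nat m else 0)"
  proof (intro prod.cong refl)
    fix i assume i: "i \<in> {1..l}"
    have "b i \<in> {0..<int m}" "d i \<in> {0..<int m}"
      using b d i by (auto simp: Zvec_mem[OF m])
    hence "int m dvd b i - d i \<longleftrightarrow> b i = d i"
      by (auto simp flip: mod_eq_dvd_iff)
    thus "(\<Sum>c\<in>Zmod m. zeta m powi (c * (b i - d i))) = (if b i = d i then of_nat m else 0)"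
      by (simp add: sum_zeta_powi[OF m])
  qed
  also have "\<dots> = (if b = d then of_nat m ^ l else 0)"
  proof (cases "b = d")
    case False
    then obtain i where "i \<in> {1..l}" "b i \<noteq> d i"
      using b d PiE_ext unfolding Zvec_def by metis
    hence "(\<Prod>i=1..l. if b i = d i then of_nat m else 0 :: complex) = 0"
      by (intro prod_zero) auto
    thus ?thesis using False by simp
  qed simp
  finally show ?thesis .
qed

text \<open>
  The hypothesis determines the Fourier transform of the image under \<open>B\<close> of the weight \<open>w\<close>. It is
  that of a point mass \<open>A\<close> at \<open>d\<close>, so the two weights agree and have the same integral
  against \<open>\<psi>\<close>.
\<close>

lemma fourier_concentration:
  fixes w :: "'a \<Rightarrow> complex" and \<psi> :: "(nat \<Rightarrow> int) \<Rightarrow> complex"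
  assumes m: "m > 0" and B: "\<And>x. x \<in> X \<Longrightarrow> B x \<in> Zvec m l" and d: "d \<in> Zvec m l"
    and char: "\<And>c. c \<in> Zvec m l \<Longrightarrow>
      (\<Sum>x\<in>X. w x * zeta m powi (\<Sum>i=1..l. c i * B x i)) = A * zeta m powi (\<Sum>i=1..l. c i * d i)"
  shows "(\<Sum>x\<in>X. w x * \<psi> (B x)) = A * \<psi> d"
proof -
  let ?V = "Zvec m l"
  let ?e = "\<lambda>c b. zeta m powi (\<Sum>i=1..l. c i * b i)"
  have e_diff: "zeta m powi (\<Sum>i=1..l. c i * (b i - b' i)) = ?e c b * inverse (?e c b')" for c b b' :: "nat \<Rightarrow> int"
    by (simp add: right_diff_distrib sum_subtractf power_int_diff divide_inverse)
  have inversion: "of_nat m ^ l * \<psi> b = (\<Sum>b'\<in>?V. \<Sum>c\<in>?V. \<psi> b' * (?e c b * inverse (?e c b')))"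
    if "b \<in> ?V" for b
  proof -
    have "(\<Sum>b'\<in>?V. \<Sum>c\<in>?V. \<psi> b' * (?e c b * inverse (?e c b')))
      = (\<Sum>b'\<in>?V. \<psi> b' * (if b = b' then of_nat m ^ l else 0))"
      unfolding sum_distrib_left[symmetric] e_diff[symmetric]
      using character_orthogonality[OF m that] by (intro sum.cong) auto
    also have "\<dots> = (\<Sum>b'\<in>?V. if b = b' then \<psi> b' * of_nat m ^ l else 0)"
      by (intro sum.cong) auto
    also have "\<dots> = \<psi> b * of_nat m ^ l"
      using that finite_Zvec[OF m] by (subst sum.delta') auto
    finally show ?thesis by (simp add: mult.commute)
  qed
  have "of_nat m ^ l * (\<Sum>x\<in>X. w x * \<psi> (B x)) = (\<Sum>x\<in>X. w x * (of_nat m ^ l * \<psi> (B x)))"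
    by (simp add: sum_distrib_left mult_ac)
  also have "\<dots> = (\<Sum>x\<in>X. w x * (\<Sum>b'\<in>?V. \<Sum>c\<in>?V. \<psi> b' * (?e c (B x) * inverse (?e c b'))))"
    using inversion B by (intro sum.cong) auto
  also have "\<dots> = (\<Sum>x\<in>X. \<Sum>b'\<in>?V. \<Sum>c\<in>?V. \<psi> b' * inverse (?e c b') * (w x * ?e c (B x)))"
    by (simp add: sum_distrib_left mult_ac)
  also have "\<dots> = (\<Sum>b'\<in>?V. \<Sum>x\<in>X. \<Sum>c\<in>?V. \<psi> b' * inverse (?e c b') * (w x * ?e c (B x)))"
    by (rule sum.swap)
  also have "\<dots> = (\<Sum>b'\<in>?V. \<Sum>c\<in>?V. \<Sum>x\<in>X. \<psi> b' * inverse (?e c b') * (w x * ?e c (B x)))"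
    by (intro sum.cong refl sum.swap)
  also have "\<dots> = (\<Sum>b'\<in>?V. \<Sum>c\<in>?V. \<psi> b' * inverse (?e c b') * (A * ?e c d))"
    unfolding sum_distrib_left[symmetric] using char by (intro sum.cong refl) auto
  also have "\<dots> = A * (\<Sum>b'\<in>?V. \<Sum>c\<in>?V. \<psi> b' * (?e c d * inverse (?e c b')))"
    by (simp add: sum_distrib_left mult_ac)
  also have "\<dots> = A * (of_nat m ^ l * \<psi> d)"
    by (simp only: inversion[OF d])
  finally show ?thesis using m by simp
qed

section \<open>Digit blocks\<close>

lemma digit_sum_split:
  fixes y :: "nat \<Rightarrow> int" and b :: int
  shows "(\<Sum>i=1..m + l. b ^ (i - 1) * y i) = (\<Sum>i=1..m. b ^ (i - 1) * y i) + b ^ m * (\<Sum>j=1..l. b ^ (j - 1) * y (m + j))"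
  by (induction l) (auto simp: power_add algebra_simps)

lemma digit_sum_bounds:
  fixes y :: "nat \<Rightarrow> int" and b :: int
  assumes "b > 0" "\<And>i. i \<in> {1..l} \<Longrightarrow> y i \<in> {0..<b}"
  shows "(\<Sum>i=1..l. b ^ (i - 1) * y i) \<in> {0..<b ^ l}"
  using assms(2)
proof (induction l)
  case (Suc l)
  have IH: "(\<Sum>i=1..l. b ^ (i - 1) * y i) \<in> {0..<b ^ l}"
    using Suc by simp
  have "y (Suc l) \<in> {0..<b}" using Suc.prems by simp
  hence "b ^ l * y (Suc l) \<le> b ^ l * (b - 1)" "0 \<le> b ^ l * y (Suc l)"
    using assms(1) by (auto intro!: mult_left_mono)
  thus ?case using IH by (simp add: algebra_simps)
qed simp

lemma digit_sum_block:
  fixes y :: "nat \<Rightarrow> int" and b :: int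
  assumes b: "b > 0" and y: "\<And>i. i \<in> {1..k} \<Longrightarrow> y i \<in> {0..<b}" and le: "m + l \<le> k"
  shows "(\<Sum>i=1..k. b ^ (i - 1) * y i) div b ^ m mod b ^ l = (\<Sum>j=1..l. b ^ (j - 1) * y (m + j))"
proof -
  define A where "A = (\<Sum>i=1..m. b ^ (i - 1) * y i)"
  define B where "B = (\<Sum>j=1..l. b ^ (j - 1) * y (m + j))"
  define C where "C = (\<Sum>j=1..k - m - l. b ^ (j - 1) * y (m + (l + j)))"
  have "(\<Sum>i=1..m + (l + (k - m - l)). b ^ (i - 1) * y i) = A + b ^ m * (B + b ^ l * C)"
    unfolding digit_sum_split by (simp add: A_def B_def C_def)
  hence "(\<Sum>i=1..k. b ^ (i - 1) * y i) = A + b ^ m * (B + b ^ l * C)"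
    using le by simp
  moreover have "A \<in> {0..<b ^ m}"
    unfolding A_def using y le by (intro digit_sum_bounds b) auto
  moreover have "B \<in> {0..<b ^ l}"
    unfolding B_def using y le by (intro digit_sum_bounds b) auto
  ultimately show ?thesis
    using b unfolding B_def[symmetric] by simp
qed

lemma digit_sum_blocks:
  fixes y :: "nat \<Rightarrow> int" and b :: int
  shows "(\<Sum>i=1..l * t. b ^ (i - 1) * y i)
    = (\<Sum>i=1..l. b ^ ((i - 1) * t) * (\<Sum>j=1..t. b ^ (j - 1) * y ((i - 1) * t + j)))"
proof (induction l)
  case (Suc l)
  thus ?case
    using digit_sum_split[of b y "l * t" t] by (simp add: add.commute[of t])
qed simp


section \<open>Gbent functions and their digit blocks\<close>

locale gbent_setting =
  fixes p n k t s :: nat and f :: "(nat \<Rightarrow> int) \<Rightarrow> int" and a :: "nat \<Rightarrow> (nat \<Rightarrow> int) \<Rightarrow> int"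
  assumes prime_p: "prime p" and odd_p: "odd p"
    and k_pos: "k \<ge> 1" and t_pos: "t \<ge> 1" and s_pos: "s \<ge> 1" and st_le: "s * t \<le> k"
    and f_GB: "f \<in> GB p n k"
    and a_digit: "\<And>i. i \<in> {1..k} \<Longrightarrow> a i \<in> Zvec p n \<rightarrow> Zmod p"
    and f_digits: "\<And>x. x \<in> Zvec p n \<Longrightarrow> f x = (\<Sum>i=1..k. int p ^ (i - 1) * a i x)"
begin

sublocale prime_power_cyclotomic p k
  by unfold_locales (fact prime_p k_pos)+

(* Lets the index bounds s - 1 and k - 1 keep their form under simplification. *)
declare One_nat_def [simp del]

abbreviation K where "K \<equiv> k - (s - 1) * t"
abbreviation V where "V \<equiv> Zvec (p ^ t) (s - 1)"

definition block :: "nat \<Rightarrow> int \<Rightarrow> int" where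
  "block i v = v div int p ^ ((i - 1) * t) mod int p ^ t"

text \<open>The restriction to \<open>{1..s - 1}\<close> makes this an element of \<^term>\<open>V\<close>.\<close>

definition blocks :: "int \<Rightarrow> nat \<Rightarrow> int" where
  "blocks v = (\<lambda>i\<in>{1..s - 1}. block i v)"

definition high :: "int \<Rightarrow> int" where
  "high v = v div int p ^ ((s - 1) * t)"

text \<open>
  The image of \<open>\<zeta>\<^sup>v\<close> under the linear map that carries the transform of \<open>f\<close> to the transform of \<open>g\<^sub>c\<close>.
\<close>

definition block_char :: "(nat \<Rightarrow> int) \<Rightarrow> int \<Rightarrow> complex" where
  "block_char c v = zeta (p ^ K) powi high v * zeta (p ^ t) powi (\<Sum>i=1..s - 1. c i * block i v)"

lemma p_pos: "p > 0" using p_gt_1 by simp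

lemma low_plus_top: "(s - 1) * t + t = s * t"
  using s_pos by (cases s) simp_all

lemma K_eq: "K = (k - t * s) + t" and k_eq: "k = (s - 1) * t + K"
  using st_le low_plus_top by (auto simp: mult.commute)

lemma k_eq': "K + (s - 1) * t = k"
  using k_eq by linarith

lemma block_index: "i \<in> {1..s - 1} \<Longrightarrow> (i - 1) * t + t \<le> (s - 1) * t"
proof -
  assume "i \<in> {1..s - 1}"
  hence "(i - 1) * t + t = i * t" "i \<le> s - 1" by (cases i, auto)
  thus ?thesis by simp
qed

lemma blocks_in_V: "blocks v \<in> V"
  using p_pos by (auto simp: Zvec_mem blocks_def block_def)

lemma block_shift:
  assumes "i \<in> {1..s - 1}"
  shows "block i (v + int p ^ (k - 1)) = block i v"
proof -
  have "(i - 1) * t + t \<le> k - 1"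
    using block_index[OF assms] low_plus_top st_le t_pos by linarith
  then obtain l where l: "k - 1 = (i - 1) * t + (t + l)"
    by (metis add.assoc le_Suc_ex)
  have "int p ^ (k - 1) = int p ^ ((i - 1) * t) * (int p ^ t * int p ^ l)"
    unfolding l by (simp add: power_add)
  thus ?thesis using p_pos by (simp add: block_def)
qed

lemma high_shift: "high (v + int p ^ (k - 1)) = high v + int p ^ (K - 1)"
proof -
  have "k - 1 = (s - 1) * t + (K - 1)"
    using K_eq k_eq t_pos by linarith
  hence "int p ^ (k - 1) = int p ^ ((s - 1) * t) * int p ^ (K - 1)"
    by (metis power_add)
  thus ?thesis using p_pos by (simp add: high_def)
qed

lemma zeta_K: "zeta (p ^ K) powi (int p ^ (K - 1)) = zeta p"
proof -
  have "K \<ge> 1" using K_eq t_pos by linarith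
  hence "p ^ K = p * p ^ (K - 1)" by (cases K) simp_all
  thus ?thesis using zeta_powi_mult[of "p ^ (K - 1)" p 1] p_pos by simp
qed

text \<open>
  As \<open>s * t \<le> k\<close> and \<open>t \<ge> 1\<close>, the leading digit of \<open>v\<close> belongs to the high part and to no block.
\<close>

lemma block_char_shift: "block_char c (v + int p ^ (k - 1)) = zeta p * block_char c v"
proof -
  have "(\<Sum>i=1..s - 1. c i * block i (v + int p ^ (k - 1))) = (\<Sum>i=1..s - 1. c i * block i v)"
    using block_shift by (intro sum.cong) auto
  moreover have "zeta (p ^ K) powi (high v + int p ^ (K - 1)) = zeta p * zeta (p ^ K) powi high v"
    by (subst power_int_add, simp, subst zeta_K, rule mult.commute)
  ultimately show ?thesis
    by (simp add: block_char_def high_shift)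
qed

lemma a_range: "x \<in> Zvec p n \<Longrightarrow> i \<in> {1..k} \<Longrightarrow> a i x \<in> {0..<int p}"
  using a_digit[of i] p_pos by (auto simp: Zmod_eq)

lemma f_range: "x \<in> Zvec p n \<Longrightarrow> f x \<in> {0..<int p ^ k}"
  using f_GB p_pos by (auto simp: GB_def Zmod_eq)

lemma block_f:
  assumes x: "x \<in> Zvec p n" and i: "i \<in> {1..s - 1}"
  shows "block i (f x) = (\<Sum>j=1..t. int p ^ (j - 1) * a ((i - 1) * t + j) x)"
proof -
  have le: "(i - 1) * t + t \<le> k"
    using block_index[OF i] k_eq by linarith
  show ?thesis
    unfolding block_def f_digits[OF x]
    by (rule digit_sum_block) (use a_range[OF x] p_pos le in auto)
qed

lemma high_range:
  assumes "v \<in> {0..<int p ^ k}"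
  shows "high v \<in> {0..<int p ^ K}"
proof -
  let ?b = "int p ^ ((s - 1) * t)"
  have b: "?b > 0" using p_pos by simp
  have "int p ^ k = ?b * int p ^ K" by (metis k_eq power_add)
  moreover have "?b * (v div ?b) + v mod ?b = v" by (rule mult_div_mod_eq)
  moreover have "v mod ?b \<ge> 0" using b by (rule pos_mod_sign)
  moreover have "v < int p ^ k" using assms by simp
  ultimately have "?b * (v div ?b) < ?b * int p ^ K" by linarith
  hence "v div ?b < int p ^ K" using b by (simp only: mult_less_cancel_left_pos)
  moreover have "v div ?b \<ge> 0" using assms b by (simp add: pos_imp_zdiv_nonneg_iff)
  ultimately show ?thesis by (simp add: high_def)
qed

lemma high_f:
  assumes x: "x \<in> Zvec p n"
  shows "high (f x) = (\<Sum>i=1..K. int p ^ (i - 1) * a ((s - 1) * t + i) x)"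
proof -
  have "high (f x) \<in> {0..<int p ^ K}"
    by (rule high_range[OF f_range[OF x]])
  hence "high (f x) = f x div int p ^ ((s - 1) * t) mod int p ^ K"
    by (simp add: high_def)
  also have "\<dots> = (\<Sum>i=1..K. int p ^ (i - 1) * a ((s - 1) * t + i) x)"
    unfolding f_digits[OF x]
    by (rule digit_sum_block) (use a_range[OF x] p_pos k_eq in auto)
  finally show ?thesis .
qed

text \<open>
  The first sum in the definition of \<open>g\<^sub>c\<close> and the top \<open>t\<close> digits in its second bracket together make up
  the high part of \<open>f(x)\<close>; the remaining terms are the pairing of \<open>c\<close> with the blocks of \<open>f(x)\<close>.
\<close>

lemma zeta_gfun:
  assumes x: "x \<in> Zvec p n"
  shows "zeta (p ^ K) powi gfun p k t s a c x = block_char c (f x)"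
proof -
  have pK: "p ^ K = p ^ t * p ^ (k - t * s)"
    using K_eq by (metis add.commute power_add)
  have idx: "t * (s - 1) + (k - t * s + j) = k - t + j" for j
    using K_eq k_eq by (simp add: mult.commute)
  have high: "high (f x) = (\<Sum>i=1..k - t * s. int p ^ (i - 1) * a (t * (s - 1) + i) x)
      + int p ^ (k - t * s) * (\<Sum>j=1..t. int p ^ (j - 1) * a (k - t + j) x)"
    unfolding high_f[OF x] by (subst K_eq, subst digit_sum_split) (simp only: mult.commute[of "s - 1"] idx)
  have "(\<Sum>i=1..s - 1. c i * (\<Sum>j=1..t. int p ^ (j - 1) * a ((i - 1) * t + j) x))
      = (\<Sum>i=1..s - 1. c i * block i (f x))"
    using block_f[OF x] by (intro sum.cong) auto
  hence "gfun p k t s a c x = (high (f x) + int p ^ (k - t * s) * (\<Sum>i=1..s - 1. c i * block i (f x)))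
      mod int (p ^ K)"
    unfolding gfun_def high by (simp add: algebra_simps)
  hence "zeta (p ^ K) powi gfun p k t s a c x
      = zeta (p ^ K) powi (high (f x) + int (p ^ (k - t * s)) * (\<Sum>i=1..s - 1. c i * block i (f x)))"
    using p_pos by (simp only: zeta_powi_mod zero_less_power of_nat_power [of p "k - t * s"])
  also have "\<dots> = zeta (p ^ K) powi high (f x) * zeta (p ^ K) powi (int (p ^ (k - t * s)) * (\<Sum>i=1..s - 1. c i * block i (f x)))"
    by (rule power_int_add) simp
  also have "zeta (p ^ K) powi (int (p ^ (k - t * s)) * (\<Sum>i=1..s - 1. c i * block i (f x)))
      = zeta (p ^ t) powi (\<Sum>i=1..s - 1. c i * block i (f x))"
    unfolding pK using p_pos by (intro zeta_powi_mult) simp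
  finally show ?thesis by (simp add: block_char_def)
qed

lemma WHT_gfun:
  "WHT p n K (gfun p k t s a c) u = of_real (real p powr (- real n / 2)) *
     (\<Sum>x\<in>Zvec p n. zeta p powi (- dotp p n u x) * block_char c (f x))"
  unfolding WHT_def using zeta_gfun by (intro arg_cong2[of _ _ _ _ "(*)"] sum.cong refl) simp_all

lemma zeta_f:
  assumes x: "x \<in> Zvec p n"
  shows "z powi f x = z powi (\<Sum>i=1..s - 1. int p ^ ((i - 1) * t) * block i (f x)) * zeta (p ^ K) powi high (f x)"
proof -
  have "f x = (\<Sum>i=1..(s - 1) * t. int p ^ (i - 1) * a i x)
      + int p ^ ((s - 1) * t) * (\<Sum>i=1..K. int p ^ (i - 1) * a ((s - 1) * t + i) x)"
    using digit_sum_split[where b = "int p" and y = "\<lambda>i. a i x" and m = "(s - 1) * t" and l = K]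
    by (simp only: f_digits[OF x] k_eq[symmetric])
  also have "(\<Sum>i=1..(s - 1) * t. int p ^ (i - 1) * a i x)
      = (\<Sum>i=1..s - 1. int p ^ ((i - 1) * t) * block i (f x))"
    by (rule trans[OF digit_sum_blocks], rule sum.cong[OF refl]) (simp only: block_f[OF x])
  also have "int p ^ ((s - 1) * t) * (\<Sum>i=1..K. int p ^ (i - 1) * a ((s - 1) * t + i) x)
      = int (p ^ ((s - 1) * t)) * high (f x)"
    by (simp only: high_f[OF x] of_nat_power)
  finally have "z powi f x = z powi ((\<Sum>i=1..s - 1. int p ^ ((i - 1) * t) * block i (f x))
      + int (p ^ ((s - 1) * t)) * high (f x))"
    by (rule arg_cong)
  also have "\<dots> = z powi (\<Sum>i=1..s - 1. int p ^ ((i - 1) * t) * block i (f x))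
      * z powi (int (p ^ ((s - 1) * t)) * high (f x))"
    by (rule power_int_add) simp
  also have "z powi (int (p ^ ((s - 1) * t)) * high (f x)) = zeta (p ^ K) powi high (f x)"
  proof -
    have "q = p ^ K * p ^ ((s - 1) * t)"
      by (simp only: k_eq' flip: power_add)
    moreover have "p ^ ((s - 1) * t) > 0" using p_pos by simp
    ultimately show ?thesis using zeta_powi_mult by (simp only:)
  qed
  finally show ?thesis .
qed

lemma gfun_GB: "gfun p k t s a c \<in> GB p n K"
  using p_pos by (auto simp: GB_def Zmod_eq gfun_def)

lemma zeta_dotp:
  "zeta (p ^ t) powi dotp (p ^ t) l c d = zeta (p ^ t) powi (\<Sum>i=1..l. c i * d i)"
  unfolding dotp_def using p_pos by (intro zeta_powi_mod) simp

abbreviation wht_const :: "complex \<Rightarrow> complex" where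
  "wht_const \<epsilon> \<equiv> (if even n \<or> (odd n \<and> [p = 1] (mod 4)) then \<epsilon> else \<epsilon> * \<i>)"

text \<open>
  With \<open>w = \<plusminus>\<zeta>\<^sup>m G\<^sup>n\<close> for the unnormalized transform of \<open>f\<close>, the numbers \<open>d\<close> and \<open>j\<close> are read off the
  digits of \<open>m\<close>. The sign \<open>\<epsilon>\<close> is that of \<open>w\<close> times the one coming from \<open>G\<^sup>n / p\<^bsup>n/2\<^esup>\<close>.
\<close>

lemma wht_of_gbent:
  assumes gb: "gbent p n k f" and u: "u \<in> Zvec p n"
  obtains \<epsilon> d j where "\<epsilon> \<in> {1, - 1 :: complex}" "d \<in> V" "j \<in> Zmod (p ^ K)"
    "\<And>c. WHT p n K (gfun p k t s a c) u =
      wht_const \<epsilon> * zeta (p ^ K) powi j * zeta (p ^ t) powi (\<Sum>i=1..s - 1. c i * d i)"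
proof -
  define \<kappa> where "\<kappa> = real p powr (- real n / 2)"
  define w where "w = (\<Sum>x\<in>Zvec p n. zeta p powi (- dotp p n u x) * z ^ nat (f x))"
  have pow_f: "z powi f x = z ^ nat (f x)" if "x \<in> Zvec p n" for x
    using f_range[OF that] by (simp add: power_int_def)
  have "WHT p n k f u = of_real \<kappa> * w"
    unfolding WHT_def \<kappa>_def w_def using pow_f by simp
  hence "\<kappa> * cmod w = 1"
    using gb u by (auto simp: gbent_def norm_mult \<kappa>_def)
  hence "\<kappa>\<^sup>2 * (cmod w)\<^sup>2 = 1"
    by (metis power_mult_distrib power_one)
  moreover have "\<kappa>\<^sup>2 = 1 / real p ^ n"
    using p_pos by (simp add: \<kappa>_def powr_power powr_minus powr_realpow field_simps)
  ultimately have "(cmod w)\<^sup>2 = real p ^ n"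
    using p_pos by (simp add: field_simps)
  hence nrm: "w * cnj w = of_nat p ^ n"
    by (metis complex_norm_square of_real_of_nat_eq of_real_power)
  have wR: "w \<in> R"
    unfolding w_def using cyc_ints_zeta_p_subset p_pos
    by (intro cyc_ints_sum cyc_ints_mult cyc_ints_power cyc_ints_zeta) blast
  obtain \<sigma> m where \<sigma>: "\<sigma> \<in> {1, - 1 :: int}" and m: "m < q" and w: "w = of_int \<sigma> * z ^ m * gauss_root p ^ n"
    using norm_p_power_imp_gauss_root_power[OF odd_p wR nrm] by blast
  obtain \<epsilon> where \<epsilon>: "\<epsilon> \<in> {1, - 1}" "of_real \<kappa> * gauss_root p ^ n = wht_const \<epsilon>"
    using gauss_root_normalized[OF prime_p odd_p] unfolding \<kappa>_def by metis
  show ?thesis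
  proof (rule that)
    show "of_int \<sigma> * \<epsilon> \<in> {1, - 1}" using \<sigma> \<epsilon>(1) by auto
    show "blocks (int m) \<in> V" by (rule blocks_in_V)
    have "int m < int p ^ k"
      using m by (metis of_nat_less_iff of_nat_power)
    hence "high (int m) \<in> {0..<int p ^ K}"
      by (intro high_range) simp
    thus "high (int m) \<in> Zmod (p ^ K)"
      using p_pos by (simp add: Zmod_eq)
  next
    fix c
    have "(\<Sum>x\<in>Zvec p n. zeta p powi (- dotp p n u x) * block_char c (f x))
        = (\<Sum>x\<in>Zvec p n. zeta p powi (- dotp p n u x) * block_char c (int (nat (f x))))"
      using f_range by (intro sum.cong) auto
    also have "\<dots> = of_int \<sigma> * block_char c (int m) * gauss_root p ^ n"
    proof (rule transfer_sum_of_powers)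
      show "block_char c (int (v + r)) = zeta p * block_char c (int v)" for v
        using block_char_shift[of c "int v"] by (simp only: of_nat_add of_nat_power)
      show "gauss_root p ^ n \<in> cyc_ints p"
        using gauss_root_in_cyc_ints p_pos by blast
    qed (use w in \<open>simp add: w_def\<close>)
    finally have "WHT p n K (gfun p k t s a c) u = of_int \<sigma> * (of_real \<kappa> * gauss_root p ^ n) * block_char c (int m)"
      by (simp add: WHT_gfun \<kappa>_def)
    also have "block_char c (int m) = zeta (p ^ K) powi high (int m)
        * zeta (p ^ t) powi (\<Sum>i=1..s - 1. c i * blocks (int m) i)"
      by (simp add: block_char_def blocks_def)
    finally show "WHT p n K (gfun p k t s a c) u = wht_const (of_int \<sigma> * \<epsilon>)
        * zeta (p ^ K) powi high (int m) * zeta (p ^ t) powi (\<Sum>i=1..s - 1. c i * blocks (int m) i)"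
      unfolding \<epsilon>(2) by simp
  qed
qed

text \<open>
  Fourier inversion with respect to \<open>c\<close>. The function \<open>\<psi>\<close> is the contribution of the low digits to
  \<open>\<zeta>\<^bsup>f(x)\<^esup>\<close>, and \<open>w\<close> is the remaining factor of the terms of the transform.
\<close>

lemma gbent_of_wht:
  assumes wht: "\<And>u. u \<in> Zvec p n \<Longrightarrow> \<exists>d\<in>V. \<exists>A. cmod A = 1 \<and> (\<forall>c\<in>V.
      WHT p n K (gfun p k t s a c) u = A * zeta (p ^ t) powi (\<Sum>i=1..s - 1. c i * d i))"
  shows "gbent p n k f"
  unfolding gbent_def
proof (intro conjI ballI)
  fix u assume "u \<in> Zvec p n"
  then obtain d A where d: "d \<in> V" and A: "cmod A = 1"
    and eq: "\<And>c. c \<in> V \<Longrightarrow> WHT p n K (gfun p k t s a c) u = A * zeta (p ^ t) powi (\<Sum>i=1..s - 1. c i * d i)"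
    using wht by blast
  define \<psi> where "\<psi> = (\<lambda>b :: nat \<Rightarrow> int. z powi (\<Sum>i=1..s - 1. int p ^ ((i - 1) * t) * b i))"
  define w where "w = (\<lambda>x. of_real (real p powr (- real n / 2)) * zeta p powi (- dotp p n u x)
    * zeta (p ^ K) powi high (f x))"
  have "(\<Sum>x\<in>Zvec p n. w x * \<psi> (blocks (f x))) = A * \<psi> d"
  proof (rule fourier_concentration)
    fix c assume "c \<in> V"
    have "(\<Sum>x\<in>Zvec p n. w x * zeta (p ^ t) powi (\<Sum>i=1..s - 1. c i * blocks (f x) i))
        = WHT p n K (gfun p k t s a c) u"
      unfolding WHT_gfun by (simp add: w_def block_char_def blocks_def sum_distrib_left mult_ac)
    thus "(\<Sum>x\<in>Zvec p n. w x * zeta (p ^ t) powi (\<Sum>i=1..s - 1. c i * blocks (f x) i))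
        = A * zeta (p ^ t) powi (\<Sum>i=1..s - 1. c i * d i)"
      using eq[OF \<open>c \<in> V\<close>] by simp
  qed (use p_pos d blocks_in_V in auto)
  moreover have "(\<Sum>x\<in>Zvec p n. w x * \<psi> (blocks (f x))) = WHT p n k f u"
    by (simp add: WHT_def zeta_f w_def \<psi>_def blocks_def sum_distrib_left mult_ac)
  ultimately show "cmod (WHT p n k f u) = 1"
    using A by (metis \<psi>_def norm_mult norm_zeta_powi mult_1)
qed (fact f_GB)

end

theorem theorem3p2:
  fixes p n k t s :: nat
    and f :: "(nat \<Rightarrow> int) \<Rightarrow> int"
    and a :: "nat \<Rightarrow> (nat \<Rightarrow> int) \<Rightarrow> int"
  assumes "prime p" and "odd p"
    and "n \<ge> 1" and "k \<ge> 1" and "t \<ge> 1"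
    and "f \<in> GB p n k"
    and "\<And>i. i \<in> {1..k} \<Longrightarrow> a i \<in> Zvec p n \<rightarrow> Zmod p"
    and "\<And>x. x \<in> Zvec p n \<Longrightarrow> f x = (\<Sum>i=1..k. int p ^ (i - 1) * a i x)"
    and "s \<ge> 1" and "s * t \<le> k"
  shows "gbent p n k f \<longleftrightarrow>
    (\<forall>c\<in>Zvec (p ^ t) (s - 1). gbent p n (k - (s - 1) * t) (gfun p k t s a c)) \<and>
    (\<forall>u\<in>Zvec p n. \<exists>d\<in>Zvec (p ^ t) (s - 1). \<exists>j\<in>Zmod (p ^ (k - (s - 1) * t)).
      \<exists>\<epsilon>\<in>{1, - 1 :: complex}. \<forall>c\<in>Zvec (p ^ t) (s - 1).
        WHT p n (k - (s - 1) * t) (gfun p k t s a c) u =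
          (if even n \<or> (odd n \<and> [p = 1] (mod 4)) then \<epsilon> else \<epsilon> * \<i>) *
          zeta (p ^ (k - (s - 1) * t)) powi j * zeta (p ^ t) powi dotp (p ^ t) (s - 1) c d)"
    (is "_ \<longleftrightarrow> ?bent \<and> ?wht")
proof -
  interpret gbent_setting p n k t s f a
    by unfold_locales (fact assms)+
  have norm_const: "cmod (wht_const \<epsilon>) = 1" if "\<epsilon> \<in> {1, - 1}" for \<epsilon>
    using that by (cases "\<epsilon> = 1") (simp_all add: norm_mult)
  show ?thesis
  proof (intro iffI conjI ballI)
    fix c u assume "gbent p n k f"
    hence "cmod (WHT p n K (gfun p k t s a c) u) = 1" if u: "u \<in> Zvec p n" for u
    proof (rule wht_of_gbent[OF _ u])
      fix \<epsilon> d j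
      assume "\<epsilon> \<in> {1, - 1 :: complex}" and eq: "\<And>c. WHT p n K (gfun p k t s a c) u =
        wht_const \<epsilon> * zeta (p ^ K) powi j * zeta (p ^ t) powi (\<Sum>i=1..s - 1. c i * d i)"
      thus ?thesis unfolding eq norm_mult by (simp only: norm_const norm_zeta_powi mult_1_right)
    qed
    thus "gbent p n K (gfun p k t s a c)"
      using gfun_GB by (simp add: gbent_def)
  next
    fix u assume "gbent p n k f" "u \<in> Zvec p n"
    then obtain \<epsilon> d j where "\<epsilon> \<in> {1, - 1 :: complex}" "d \<in> V" "j \<in> Zmod (p ^ K)"
      "\<And>c. WHT p n K (gfun p k t s a c) u =
        wht_const \<epsilon> * zeta (p ^ K) powi j * zeta (p ^ t) powi (\<Sum>i=1..s - 1. c i * d i)"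
      by (rule wht_of_gbent) (rule that; assumption)
    thus "\<exists>d\<in>V. \<exists>j\<in>Zmod (p ^ K). \<exists>\<epsilon>\<in>{1, - 1 :: complex}. \<forall>c\<in>V.
      WHT p n K (gfun p k t s a c) u = wht_const \<epsilon> * zeta (p ^ K) powi j * zeta (p ^ t) powi dotp (p ^ t) (s - 1) c d"
      by (intro bexI[of _ d] bexI[of _ j] bexI[of _ \<epsilon>] ballI) (simp_all only: zeta_dotp)
  next
    assume "?bent \<and> ?wht"
    show "gbent p n k f"
    proof (rule gbent_of_wht)
      fix u assume "u \<in> Zvec p n"
      then obtain d j \<epsilon> where d: "d \<in> V" and \<epsilon>: "\<epsilon> \<in> {1, - 1 :: complex}"
        and eq: "\<forall>c\<in>V. WHT p n K (gfun p k t s a c) u = wht_const \<epsilon> * zeta (p ^ K) powi j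
          * zeta (p ^ t) powi (\<Sum>i=1..s - 1. c i * d i)"
        using bspec[OF conjunct2[OF \<open>?bent \<and> ?wht\<close>], unfolded zeta_dotp] by blast
      have "cmod (wht_const \<epsilon> * zeta (p ^ K) powi j) = 1"
        unfolding norm_mult norm_const[OF \<epsilon>] by simp
      thus "\<exists>d\<in>V. \<exists>A. cmod A = 1 \<and> (\<forall>c\<in>V.
          WHT p n K (gfun p k t s a c) u = A * zeta (p ^ t) powi (\<Sum>i=1..s - 1. c i * d i))"
        using d eq by blast
    qed
  qed
qed

end
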